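(* Let $\prod_{j=1}^\infty |P_j|^2$ be a generalized Riesz product, where each $P_j$ is an analytic trigonometric polynomial with positive constant term $a_0^{(j)}$. Put $S_n=\prod_{j=1}^n P_j$ and $b=\lim_{n\to\infty}\prod_{j=1}^n a_0^{(j)}$ (this limit exists and lies in $[0,1]$). (a) If $b=0$, then the sequence $S_n$, $n=1,2,\dots$, converges to zero weakly in $L^2(S^1,dz)$. (b) If $b>0$, then $S_n$ converges in $L^1(S^1,dz)$ norm (and in $H^1$ norm) to a non-zero function $f$ which also belongs to $H^2$ with $H^2$ norm at most $1$, and $\log|f|$ has finite integral with respect to $dz$.
   Context: $S^1$ is the unit circle and $dz$ denotes normalized Lebesgue (Haar) measure on $S^1$. An analytic trigonometric polynomial is one of the form $\sum_{i=0}^m a_i z^i$. $H^p$ are the usual Hardy spaces, identified with subspaces of $L^p(S^1,dz)$ via boundary values. Generalized Riesz product: a sequence $P_1,P_2,\dots$ of trigonometric polynomials on $S^1$ is said to define a generalized Riesz product if (i) for every finite sequence $i_1<\dots<i_k$ of natural numbers, $\int_{S^1}|P_{i_1}\cdots P_{i_k}(z)|^2\,dz=1$; and (ii) for every infinite sequence $i_1<i_2<\cdots$ of natural numbers, the weak limit of the probability measures $|P_{i_1}\cdots P_{i_k}(z)|^2\,dz$ as $k\to\infty$ exists. The weak limit $\mu$ of $|P_1\cdots P_k|^2dz$ is called the generalized Riesz product and is denoted $\mu=\prod_{j=1}^\infty|P_j|^2$. *)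

theory Defs
  imports "HOL-Analysis.Analysis" "HOL-Computational_Algebra.Polynomial" "HOL-Probability.Probability"
begin

definition circle :: "complex set" where
  "circle = sphere 0 1"

definition circle_borel :: "complex measure" where
  "circle_borel = restrict_space borel circle"

text \<open>Normalized arc length, i.e. the normalized Haar measure \<open>dz\<close> of the circle group.\<close>

definition dz :: "complex measure" where
  "dz = distr (uniform_measure lborel {0..2 * pi}) circle_borel cis"

lemma space_circle_borel [simp]: "space circle_borel = circle"
  by (simp add: circle_borel_def space_restrict_space)

lemma space_dz [simp]: "space dz = circle"
  by (simp add: dz_def)

lemma sets_dz [measurable_cong]: "sets dz = sets circle_borel"
  by (simp add: dz_def)

lemma prob_space_dz: "prob_space dz"
  unfolding dz_def
proof (rule prob_space.prob_space_distr)
  show "prob_space (uniform_measure lborel {0..2 * pi})"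
    by (rule prob_space_uniform_measure) auto
  show "cis \<in> uniform_measure lborel {0..2 * pi} \<rightarrow>\<^sub>M circle_borel"
    unfolding circle_borel_def circle_def
  proof (rule measurable_restrict_space2)
    have "cis \<in> borel_measurable borel"
      by (intro borel_measurable_continuous_onI continuous_intros)
    then show "cis \<in> borel_measurable (uniform_measure lborel {0..2 * pi})"
      by (simp cong: measurable_cong_sets)
  qed auto
qed

definition trig_polynomial :: "(complex \<Rightarrow> complex) \<Rightarrow> bool" where
  "trig_polynomial P \<longleftrightarrow>
     (\<exists>(N::nat) (c :: int \<Rightarrow> complex).
        \<forall>z\<in>circle. P z = (\<Sum>k = - int N..int N. c k * z powi k))"

text \<open>Analytic trigonometric polynomials are represented by ordinary complex polynomials.\<close>

lemma trig_polynomial_poly: "trig_polynomial (poly p)"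
  unfolding trig_polynomial_def
proof (intro exI ballI)
  fix z :: complex
  assume "z \<in> circle"
  define c where "c = (\<lambda>k::int. if k < 0 then 0 else coeff p (nat k))"
  have "(\<Sum>k = - int (degree p)..int (degree p). c k * z powi k) =
        (\<Sum>k\<in>int ` {..degree p}. c k * z powi k)"
  proof (rule sum.mono_neutral_right)
    show "\<forall>k\<in>{- int (degree p)..int (degree p)} - int ` {..degree p}. c k * z powi k = 0"
    proof
      fix k assume k: "k \<in> {- int (degree p)..int (degree p)} - int ` {..degree p}"
      have "k < 0"
      proof (rule ccontr)
        assume "\<not> k < 0"
        then have "k = int (nat k)" "nat k \<le> degree p" using k by auto
        then show False using k by blast
      qed
      then show "c k * z powi k = 0" by (simp add: c_def)
    qed
  qed auto
  also have "\<dots> = (\<Sum>i\<le>degree p. coeff p i * z ^ i)"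
    by (subst sum.reindex) (auto simp: c_def)
  also have "\<dots> = poly p z" by (simp add: poly_altdef)
  finally show "poly p z = (\<Sum>k = - int (degree p)..int (degree p).
      (\<lambda>k::int. if k < 0 then 0 else coeff p (nat k)) k * z powi k)"
    by (simp add: c_def)
qed

definition weak_conv_circle :: "(nat \<Rightarrow> complex measure) \<Rightarrow> complex measure \<Rightarrow> bool" where
  "weak_conv_circle M \<mu> \<longleftrightarrow>
     sets \<mu> = sets circle_borel \<and> finite_measure \<mu> \<and>
     (\<forall>f :: complex \<Rightarrow> real. continuous_on circle f \<longrightarrow>
        (\<lambda>k. \<integral>z. f z \<partial>M k) \<longlonglongrightarrow> (\<integral>z. f z \<partial>\<mu>))"

definition sq_density :: "(complex \<Rightarrow> complex) \<Rightarrow> complex measure" where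
  "sq_density Q = density dz (\<lambda>z. ennreal ((cmod (Q z))\<^sup>2))"

text \<open>
  The sequence is indexed from \<open>0\<close>.  A finite sequence of indices \<open>i\<^sub>1 < \<dots> < i\<^sub>k\<close> is given
  by its set of values, an infinite one by a strictly increasing function.
\<close>

definition defines_generalized_riesz_product :: "(nat \<Rightarrow> complex \<Rightarrow> complex) \<Rightarrow> bool" where
  "defines_generalized_riesz_product P \<longleftrightarrow>
     (\<forall>j. trig_polynomial (P j)) \<and>
     (\<forall>I. finite I \<longrightarrow> I \<noteq> {} \<longrightarrow> (\<integral>z. (cmod (\<Prod>i\<in>I. P i z))\<^sup>2 \<partial>dz) = 1) \<and>
     (\<forall>i :: nat \<Rightarrow> nat. strict_mono i \<longrightarrow>
        (\<exists>\<nu>. weak_conv_circle (\<lambda>k. sq_density (\<lambda>z. \<Prod>j<k. P (i j) z)) \<nu>))"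

definition generalized_riesz_product ::
    "(nat \<Rightarrow> complex \<Rightarrow> complex) \<Rightarrow> complex measure \<Rightarrow> bool" where
  "generalized_riesz_product P \<mu> \<longleftrightarrow>
     defines_generalized_riesz_product P \<and>
     weak_conv_circle (\<lambda>k. sq_density (\<lambda>z. \<Prod>j<k. P j z)) \<mu>"

definition Lp_circle :: "real \<Rightarrow> (complex \<Rightarrow> complex) set" where
  "Lp_circle p = {f \<in> borel_measurable dz. integrable dz (\<lambda>z. cmod (f z) powr p)}"

definition Lp_norm :: "real \<Rightarrow> (complex \<Rightarrow> complex) \<Rightarrow> real" where
  "Lp_norm p f = (\<integral>z. cmod (f z) powr p \<partial>dz) powr (1 / p)"

definition weakly_tendsto_L2 :: "(nat \<Rightarrow> complex \<Rightarrow> complex) \<Rightarrow> (complex \<Rightarrow> complex) \<Rightarrow> bool" where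
  "weakly_tendsto_L2 F f \<longleftrightarrow>
     (\<forall>n. F n \<in> Lp_circle 2) \<and> f \<in> Lp_circle 2 \<and>
     (\<forall>g\<in>Lp_circle 2. (\<lambda>n. \<integral>z. F n z * cnj (g z) \<partial>dz) \<longlonglongrightarrow> (\<integral>z. f z * cnj (g z) \<partial>dz))"

text \<open>
  The Hardy space \<open>H\<^sup>p\<close> (\<open>0 < p < \<infinity>\<close>) of the open unit disc.  The supremum in the norm is
  meaningful for members of the space.
\<close>

definition hardy_space :: "real \<Rightarrow> (complex \<Rightarrow> complex) set" where
  "hardy_space p =
     {F. F holomorphic_on ball 0 1 \<and>
         bdd_above ((\<lambda>r. Lp_norm p (\<lambda>z. F (of_real r * z))) ` {0..<1})}"

definition hardy_norm :: "real \<Rightarrow> (complex \<Rightarrow> complex) \<Rightarrow> real" where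
  "hardy_norm p F = (SUP r\<in>{0..<1}. Lp_norm p (\<lambda>z. F (of_real r * z)))"

text \<open>
  \<open>f \<in> L\<^sup>p\<close> is identified with the element \<open>F\<close> of \<open>H\<^sup>p\<close> whose radial limits it is.
\<close>

definition hardy_boundary :: "real \<Rightarrow> (complex \<Rightarrow> complex) \<Rightarrow> (complex \<Rightarrow> complex) \<Rightarrow> bool" where
  "hardy_boundary p F f \<longleftrightarrow>
     F \<in> hardy_space p \<and> f \<in> Lp_circle p \<and>
     (AE z in dz. ((\<lambda>r. F (of_real r * z)) \<longlongrightarrow> f z) (at_left (1::real)))"

text \<open>
  Since \<open>ln 0 = 0\<close> in HOL, almost everywhere finiteness of \<open>log |f|\<close> is required separately.
\<close>

definition log_integrable :: "(complex \<Rightarrow> complex) \<Rightarrow> bool" where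
  "log_integrable f \<longleftrightarrow>
     (AE z in dz. f z \<noteq> 0) \<and> integrable dz (\<lambda>z. ln (cmod (f z)))"

end

theory Submission
  imports Defs "HOL-Complex_Analysis.Complex_Analysis" "HOL-Computational_Algebra.Fundamental_Theorem_Algebra"
begin

text \<open>
  The first idea is that a block \<open>Q m n = P m * \<dots> * P (n - 1)\<close> of the product has \<open>L\<^sup>2\<close> norm one, and
  its mean over the circle is the product of the constant terms \<open>a m, \<dots>, a (n - 1)\<close>. In
  particular every \<open>a j\<close> is at most \<open>1\<close>, so the products of the \<open>a j\<close> decrease to some \<open>b\<close> in \<open>[0, 1]\<close>.

  If \<open>b = 0\<close>, every Fourier coefficient of \<open>S n\<close> tends to zero. Indeed \<open>S n = S l * Q l n\<close>, so the
  coefficient of order \<open>d\<close> of \<open>S n\<close> is the constant term of \<open>S l\<close> (small for large \<open>l\<close>) times a bounded number,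
  plus a combination of lower-order coefficients of \<open>Q l n\<close>, which tend to zero by induction
  (\<open>coeffs_of_tails_tendsto_zero\<close>). For a bounded sequence of polynomials in \<open>L\<^sup>2\<close> this amounts to weak convergence to
  zero (\<open>weakly_tendsto_zero_if_coeffs_tendsto_zero\<close>).

  If \<open>b > 0\<close>, the mean of \<open>Q m n\<close> is close to \<open>1\<close> for large \<open>m\<close>. A function of norm one and mean
  close to one is close to the constant \<open>1\<close> in \<open>L\<^sup>2\<close>, hence \<open>S n - S m = S m * (Q m n - 1)\<close> is small in
  \<open>L\<^sup>1\<close> by the Cauchy--Schwarz inequality (\<open>L1_dist_product_le\<close>), and \<open>S n\<close> converges in \<open>L\<^sup>1\<close> to some \<open>f\<close>.
  Fatou's lemma puts \<open>f\<close> into \<open>L\<^sup>2\<close>.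

  It remains to identify \<open>f\<close> with an element of the Hardy spaces of the disc. Its holomorphic extension \<open>F\<close> is the power
  series of its Fourier coefficients. The Hardy norms are controlled because dilation
  does not increase the \<open>L\<^sup>1\<close> norm of a polynomial (maximum principle,
  \<open>integral_norm_poly_dilation_le\<close>) nor its \<open>L\<^sup>2\<close> norm (Parseval). That \<open>F\<close> has radial limits \<open>f\<close> almost
  everywhere is Fatou's theorem (\<open>radial_limits_of_hardy_extension\<close>). Its proof integrates by
  parts in the Poisson integral: at almost every point the indefinite integral of \<open>f\<close> is
  differentiable, and the derivative of the Poisson kernel, which has the sign of the sine, turns
  this into a radial limit. The kernel is applied only to primitives of polynomials, and the
  estimates are passed to the limit.

  Finally \<open>log \<bar>f\<bar>\<close> is integrable (\<open>log_integrable_L1_limit\<close>): Jensen's inequality bounds the integral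
  of \<open>log \<bar>S n\<bar>\<close> below by \<open>log \<bar>S n 0\<bar> \<ge> log b\<close>, the positive part is dominated by \<open>\<bar>S n\<bar>\<close>, and Fatou's
  lemma transfers the bound for the negative part to \<open>f\<close>. In particular \<open>f\<close> is almost everywhere
  nonzero.
\<close>

section \<open>Integration on the circle\<close>

lemma cis_in_circle [simp]: "cis t \<in> circle"
  by (simp add: circle_def)

lemma measurable_cis_circle: "cis \<in> borel \<rightarrow>\<^sub>M circle_borel"
  unfolding circle_borel_def circle_def
  by (intro measurable_restrict_space2 borel_measurable_continuous_onI continuous_intros) auto

text \<open>A density with respect to Lebesgue measure turns integrals over the circle into integrals over an
  interval of angles by the change-of-variables rules for densities and image measures.\<close>

lemma dz_eq_distr_density:
  "dz = distr (density lborel (\<lambda>t. ennreal (indicator {0..2*pi} t / (2*pi)))) circle_borel cis"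
proof -
  have "uniform_measure lborel {0..2 * pi} = density lborel (\<lambda>t. ennreal (indicator {0..2*pi} t / (2*pi)))"
    unfolding uniform_measure_def
    by (intro arg_cong2[where f=density] refl ext)
       (auto simp: indicator_def divide_ennreal[symmetric] ennreal_1[symmetric] simp del: ennreal_1)
  then show ?thesis by (simp add: dz_def)
qed

lemma measurable_dz_cis:
  assumes "g \<in> borel_measurable dz"
  shows "(\<lambda>t. g (cis t)) \<in> borel_measurable borel"
proof -
  have "g \<in> borel_measurable circle_borel"
    using assms by (simp cong: measurable_cong_sets add: sets_dz)
  then show ?thesis
    using measurable_compose[OF measurable_cis_circle] by blast
qed

lemma integrable_dz_iff:
  fixes g :: "complex \<Rightarrow> 'a::{banach,second_countable_topology}"
  assumes [measurable]: "g \<in> borel_measurable dz"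
  shows "integrable dz g \<longleftrightarrow> set_integrable lborel {0..2*pi} (\<lambda>t. g (cis t))"
proof -
  have m: "(\<lambda>t. g (cis t)) \<in> borel_measurable lborel"
    using measurable_dz_cis[OF assms] by simp
  have g: "g \<in> borel_measurable circle_borel"
    using assms by (simp cong: measurable_cong_sets add: sets_dz)
  have c: "cis \<in> (density lborel (\<lambda>t. ennreal (indicator {0..2*pi} t / (2*pi)))) \<rightarrow>\<^sub>M circle_borel"
    using measurable_cis_circle by simp
  have "integrable dz g \<longleftrightarrow> integrable lborel (\<lambda>t. (indicator {0..2*pi} t / (2*pi)) *\<^sub>R g (cis t))"
    unfolding dz_eq_distr_density integrable_distr_eq[OF c g]
    by (subst integrable_density) (use m in \<open>auto intro!: AE_I2\<close>)
  also have "\<dots> \<longleftrightarrow> integrable lborel (\<lambda>t. (1 / (2*pi)) *\<^sub>R (indicator {0..2*pi} t *\<^sub>R g (cis t)))"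
    by (intro arg_cong[where f="integrable lborel"] ext) (auto simp: indicator_def)
  also have "\<dots> \<longleftrightarrow> set_integrable lborel {0..2*pi} (\<lambda>t. g (cis t))"
  proof -
    have *: "integrable lborel (\<lambda>t. (1 / (2*pi)) *\<^sub>R u t) \<longleftrightarrow> integrable lborel u" for u :: "real \<Rightarrow> 'a"
    proof
      assume i: "integrable lborel (\<lambda>t. (1 / (2*pi)) *\<^sub>R u t)"
      show "integrable lborel u"
        using integrable_scaleR_right[of "2*pi", OF i] by simp
    qed simp
    show ?thesis unfolding set_integrable_def by (rule *)
  qed
  finally show ?thesis .
qed

lemma integral_dz:
  fixes g :: "complex \<Rightarrow> 'a::{banach,second_countable_topology}"
  assumes [measurable]: "g \<in> borel_measurable dz"
  shows "(\<integral>z. g z \<partial>dz) = (1 / (2*pi)) *\<^sub>R (LINT t:{0..2*pi}|lborel. g (cis t))"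
proof -
  have m: "(\<lambda>t. g (cis t)) \<in> borel_measurable lborel"
    using measurable_dz_cis[OF assms] by simp
  have g: "g \<in> borel_measurable circle_borel"
    using assms by (simp cong: measurable_cong_sets add: sets_dz)
  have c: "cis \<in> (density lborel (\<lambda>t. ennreal (indicator {0..2*pi} t / (2*pi)))) \<rightarrow>\<^sub>M circle_borel"
    using measurable_cis_circle by simp
  have "(\<integral>z. g z \<partial>dz) = (\<integral>t. (indicator {0..2*pi} t / (2*pi)) *\<^sub>R g (cis t) \<partial>lborel)"
    unfolding dz_eq_distr_density integral_distr[OF c g]
    by (subst integral_density) (use m in \<open>auto intro!: AE_I2\<close>)
  also have "\<dots> = (\<integral>t. (1 / (2*pi)) *\<^sub>R (indicator {0..2*pi} t *\<^sub>R g (cis t)) \<partial>lborel)"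
    by (intro Bochner_Integration.integral_cong refl) (auto simp only: indicator_def scaleR_scaleR, auto)
  finally show ?thesis unfolding set_lebesgue_integral_def by (simp only: integral_scaleR_right)
qed

lemma borel_measurable_dz_continuous:
  fixes g :: "complex \<Rightarrow> 'a::topological_space"
  assumes "continuous_on circle g"
  shows "g \<in> borel_measurable dz"
proof -
  have "g \<in> borel_measurable circle_borel"
    unfolding circle_borel_def by (rule borel_measurable_continuous_on_restrict[OF assms])
  then show ?thesis by (simp cong: measurable_cong_sets add: sets_dz)
qed

lemma integrable_dz_continuous:
  fixes g :: "complex \<Rightarrow> 'a::{banach,second_countable_topology}"
  assumes "continuous_on circle g"
  shows "integrable dz g"
proof -
  interpret prob_space dz by (rule prob_space_dz)
  have "compact (g ` circle)"
    by (intro compact_continuous_image assms) (simp add: circle_def)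
  then obtain B where "\<forall>x\<in>g ` circle. norm x \<le> B"
    using compact_imp_bounded bounded_iff by blast
  then show ?thesis
    by (intro integrable_const_bound[where B=B] borel_measurable_dz_continuous assms AE_I2) auto
qed

lemma integral_dz_continuous:
  fixes g :: "complex \<Rightarrow> 'a::euclidean_space"
  assumes "continuous_on circle g"
  shows "(\<integral>z. g z \<partial>dz) = (1 / (2*pi)) *\<^sub>R integral {0..2*pi} (\<lambda>t. g (cis t))"
proof -
  have m: "g \<in> borel_measurable dz" by (rule borel_measurable_dz_continuous[OF assms])
  have i: "set_integrable lborel {0..2*pi} (\<lambda>t. g (cis t))"
    using integrable_dz_iff[OF m] integrable_dz_continuous[OF assms] by simp
  show ?thesis
    unfolding integral_dz[OF m] set_borel_integral_eq_integral(2)[OF i] ..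
qed

lemma continuous_on_circle_rotate:
  assumes "continuous_on circle g" "w \<in> circle"
  shows "continuous_on circle (\<lambda>z. g (w * z))"
proof (rule continuous_on_compose2[OF assms(1), of circle "\<lambda>z. w * z"])
  show "continuous_on circle (\<lambda>z. w * z)"
    by (rule continuous_on_mult[OF continuous_on_const continuous_on_id])
  show "(\<lambda>z. w * z) ` circle \<subseteq> circle"
    using assms(2) by (simp add: circle_def image_subset_iff norm_mult)
qed

text \<open>In angles a rotation is a translation. Cutting the translated interval at \<open>2 * pi\<close> and moving the
  overhanging piece back by one period recovers the original interval.\<close>

lemma integral_dz_rotate:
  fixes g :: "complex \<Rightarrow> 'a::euclidean_space"
  assumes g: "continuous_on circle g" and w: "w \<in> circle"
  shows "(\<integral>z. g (w * z) \<partial>dz) = (\<integral>z. g z \<partial>dz)"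
proof -
  define a where "a = Arg2pi w"
  have a: "0 \<le> a" "a \<le> 2*pi" "w = cis a"
  proof -
    show "0 \<le> a" "a \<le> 2*pi"
      using Arg2pi_ge_0[of w] Arg2pi_lt_2pi[of w] by (simp_all add: a_def)
    have "w = of_real (cmod w) * exp (\<i> * of_real (Arg2pi w))" by (rule Arg2pi_eq)
    then show "w = cis a" using w unfolding circle_def cis_conv_exp a_def by simp
  qed
  define h where "h = (\<lambda>t. g (cis t))"
  have ch: "continuous_on A h" for A
    unfolding h_def by (rule continuous_on_compose2[OF g, of _ cis])
      (intro continuous_on_cis continuous_intros, simp add: image_subset_iff)
  have per: "h (t + 2*pi) = h t" for t
    by (simp add: h_def cis_mult[symmetric])
  have I: "h integrable_on {x..y}" for x y
    by (rule integrable_continuous_real[OF ch])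
  have shift: "integral {x..y} (\<lambda>t. h (t + c)) = integral {x + c..y + c} h" for x y c
  proof -
    have "(h has_integral integral {x+c..y+c} h) (cbox (x+c) (y+c))"
      using integrable_integral[OF I] by simp
    from has_integral_affinity'[OF this, of 1 c]
    show ?thesis by (simp add: integral_unique)
  qed
  have "integral {0..2*pi} (\<lambda>t. h (t + a)) = integral {a..2*pi+a} h"
    using shift[of 0 "2*pi" a] by simp
  also have "\<dots> = integral {a..2*pi} h + integral {2*pi..2*pi+a} h"
    using a by (intro Henstock_Kurzweil_Integration.integral_combine[symmetric] I) auto
  also have "integral {2*pi..2*pi+a} h = integral {0..a} h"
    using shift[of 0 a "2*pi"] by (simp add: per add.commute)
  also have "integral {a..2*pi} h + integral {0..a} h = integral {0..2*pi} h"
    using a by (subst add.commute, intro Henstock_Kurzweil_Integration.integral_combine I) auto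
  finally have "integral {0..2*pi} (\<lambda>t. g (w * cis t)) = integral {0..2*pi} (\<lambda>t. g (cis t))"
    by (simp add: h_def a(3) cis_mult add.commute)
  then show ?thesis
    using integral_dz_continuous[OF g] integral_dz_continuous[OF continuous_on_circle_rotate[OF g w]]
    by simp
qed

text \<open>Rotating by a \<open>2k\<close>-th root of unity multiplies the integrand by \<open>-1\<close> but, by invariance, leaves
  the integral unchanged, so for \<open>k > 0\<close> the integral vanishes.\<close>

lemma integral_dz_power: "(\<integral>z. z ^ k \<partial>dz) = (if k = 0 then 1 else 0)"
proof (cases "k = 0")
  case True
  then show ?thesis using prob_space.prob_space[OF prob_space_dz] by simp
next
  case False
  define w where "w = cis (pi / k)"
  have "w ^ k = -1" using False by (simp add: w_def Complex.DeMoivre)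
  have "(\<integral>z. z ^ k \<partial>dz) = (\<integral>z. (w * z) ^ k \<partial>dz)"
    by (rule integral_dz_rotate[symmetric]) (auto simp: w_def intro!: continuous_intros)
  also have "\<dots> = - (\<integral>z. z ^ k \<partial>dz)"
    by (simp add: power_mult_distrib \<open>w ^ k = -1\<close>)
  finally have "2 * (\<integral>z. z ^ k \<partial>dz) = 0"
    unfolding eq_neg_iff_add_eq_0 mult_2[symmetric] .
  then show ?thesis using False by simp
qed

section \<open>Fourier coefficients of polynomials\<close>

lemma integrable_dz_mult_continuous:
  fixes g h :: "complex \<Rightarrow> complex"
  assumes g: "integrable dz g" and h: "continuous_on circle h"
  shows "integrable dz (\<lambda>z. g z * h z)"
proof -
  have "compact (h ` circle)"
    by (intro compact_continuous_image h) (simp add: circle_def)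
  then obtain B where B: "\<forall>x\<in>h ` circle. norm x \<le> B"
    using compact_imp_bounded bounded_iff by blast
  have [measurable]: "h \<in> borel_measurable dz" "g \<in> borel_measurable dz"
    using borel_measurable_dz_continuous[OF h] g by auto
  show ?thesis
  proof (rule Bochner_Integration.integrable_bound)
    show "integrable dz (\<lambda>z. B * cmod (g z))" using g by simp
    show "AE z in dz. norm (g z * h z) \<le> norm (B * cmod (g z))"
    proof (rule AE_I2)
      fix z assume "z \<in> space dz"
      then have "cmod (h z) \<le> B" using B by simp
      then have "cmod (g z) * cmod (h z) \<le> cmod (g z) * \<bar>B\<bar>" by (intro mult_left_mono) auto
      then show "norm (g z * h z) \<le> norm (B * cmod (g z))"
        by (simp add: norm_mult abs_mult mult.commute)
    qed
  qed measurable
qed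

lemma integral_dz_power_cnj_power:
  "(\<integral>z. z ^ i * cnj z ^ j \<partial>dz) = (if i = j then 1 else 0)"
proof -
  have u: "z * cnj z = 1" if "z \<in> circle" for z
    using that by (simp add: circle_def complex_norm_square[symmetric])
  show ?thesis
  proof (cases "j \<le> i")
    case True
    have "(\<integral>z. z ^ i * cnj z ^ j \<partial>dz) = (\<integral>z. z ^ (i - j) \<partial>dz)"
    proof (rule Bochner_Integration.integral_cong)
      fix z assume "z \<in> space dz"
      then have "z ^ (i - j) * (z * cnj z) ^ j = z ^ (i - j)" using u by simp
      then show "z ^ i * cnj z ^ j = z ^ (i - j)"
        using True by (simp add: power_mult_distrib mult.assoc[symmetric] power_add[symmetric])
    qed simp
    then show ?thesis using True by (simp add: integral_dz_power)
  next
    case False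
    have "(\<integral>z. z ^ i * cnj z ^ j \<partial>dz) = (\<integral>z. cnj (z ^ (j - i)) \<partial>dz)"
    proof (rule Bochner_Integration.integral_cong)
      fix z assume "z \<in> space dz"
      then have "cnj z ^ (j - i) * (z * cnj z) ^ i = cnj z ^ (j - i)" using u by simp
      then show "z ^ i * cnj z ^ j = cnj (z ^ (j - i))"
        using False
        by (simp add: power_mult_distrib mult.left_commute[of "cnj z ^ (j-i)"] power_add[symmetric])
    qed simp
    also have "\<dots> = cnj (\<integral>z. z ^ (j - i) \<partial>dz)"
      by (rule Bochner_Integration.integral_cnj)
    finally show ?thesis using False by (simp add: integral_dz_power)
  qed
qed

lemma integral_poly_cnj_power: "(\<integral>z. poly p z * cnj z ^ k \<partial>dz) = coeff p k"
proof -
  have "(\<integral>z. poly p z * cnj z ^ k \<partial>dz) = (\<integral>z. (\<Sum>i\<le>degree p. coeff p i * (z ^ i * cnj z ^ k)) \<partial>dz)"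
    by (simp add: poly_altdef sum_distrib_right mult.assoc)
  also have "\<dots> = (\<Sum>i\<le>degree p. coeff p i * (\<integral>z. z ^ i * cnj z ^ k \<partial>dz))"
    by (subst Bochner_Integration.integral_sum)
       (auto intro!: integrable_dz_continuous continuous_intros integrable_mult_right)
  also have "\<dots> = (\<Sum>i\<le>degree p. if i = k then coeff p i else 0)"
    by (intro sum.cong) (auto simp: integral_dz_power_cnj_power)
  also have "\<dots> = coeff p k"
    by (auto simp: coeff_eq_0 not_le)
  finally show ?thesis .
qed

lemma integral_times_cnj_poly:
  assumes g: "integrable dz g"
  shows "(\<integral>z. g z * cnj (poly p z) \<partial>dz) =
    (\<Sum>i\<le>degree p. cnj (coeff p i) * (\<integral>z. g z * cnj z ^ i \<partial>dz))"
proof -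
  have "(\<integral>z. g z * cnj (poly p z) \<partial>dz) =
      (\<integral>z. (\<Sum>i\<le>degree p. cnj (coeff p i) * (g z * cnj z ^ i)) \<partial>dz)"
    by (simp add: poly_altdef sum_distrib_left mult_ac)
  also have "\<dots> = (\<Sum>i\<le>degree p. cnj (coeff p i) * (\<integral>z. g z * cnj z ^ i \<partial>dz))"
    by (subst Bochner_Integration.integral_sum)
       (auto intro!: integrable_dz_mult_continuous g continuous_intros integrable_mult_right)
  finally show ?thesis .
qed

lemma continuous_on_poly_complex: "continuous_on A (\<lambda>z. poly p z)" for p :: "complex poly"
  by (rule continuous_on_poly[OF continuous_on_id])

lemma integrable_dz_poly [simp]: "integrable dz (\<lambda>z. poly p z)"
  by (rule integrable_dz_continuous[OF continuous_on_poly_complex])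

lemma integrable_dz_norm_poly_power: "integrable dz (\<lambda>z. cmod (poly p z) ^ k)"
  by (rule integrable_dz_continuous[OF continuous_on_power[OF continuous_on_norm[OF continuous_on_poly_complex]]])

lemma parseval_poly:
  "(\<integral>z. (cmod (poly p z))\<^sup>2 \<partial>dz) = (\<Sum>i\<le>degree p. (cmod (coeff p i))\<^sup>2)"
proof -
  have "complex_of_real (\<integral>z. (cmod (poly p z))\<^sup>2 \<partial>dz) = (\<integral>z. complex_of_real ((cmod (poly p z))\<^sup>2) \<partial>dz)"
    by (rule integral_complex_of_real[symmetric])
  also have "\<dots> = (\<integral>z. poly p z * cnj (poly p z) \<partial>dz)"
    by (simp only: complex_norm_square)
  also have "\<dots> = (\<Sum>i\<le>degree p. cnj (coeff p i) * coeff p i)"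
    by (subst integral_times_cnj_poly) (simp_all add: integral_poly_cnj_power)
  also have "\<dots> = complex_of_real (\<Sum>i\<le>degree p. (cmod (coeff p i))\<^sup>2)"
    by (simp only: of_real_sum complex_norm_square mult.commute)
  finally show ?thesis using of_real_eq_iff by blast
qed

lemma sum_coeff_squares_le_integral:
  "(\<Sum>i<N. (cmod (coeff p i))\<^sup>2) \<le> (\<integral>z. (cmod (poly p z))\<^sup>2 \<partial>dz)"
proof -
  have "(\<Sum>i<N. (cmod (coeff p i))\<^sup>2) \<le> (\<Sum>i\<in>{..<N} \<union> {..degree p}. (cmod (coeff p i))\<^sup>2)"
    by (intro sum_mono2) auto
  also have "\<dots> = (\<Sum>i\<le>degree p. (cmod (coeff p i))\<^sup>2)"
    by (intro sum.mono_neutral_right) (auto simp: coeff_eq_0)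
  finally show ?thesis by (simp add: parseval_poly)
qed

lemma norm_coeff_le_L2:
  "(cmod (coeff p k))\<^sup>2 \<le> (\<integral>z. (cmod (poly p z))\<^sup>2 \<partial>dz)"
proof -
  have "(cmod (coeff p k))\<^sup>2 \<le> (\<Sum>i<Suc k. (cmod (coeff p i))\<^sup>2)"
    by (rule member_le_sum) auto
  also have "\<dots> \<le> (\<integral>z. (cmod (poly p z))\<^sup>2 \<partial>dz)" by (rule sum_coeff_squares_le_integral)
  finally show ?thesis .
qed

lemma L2_circle_iff:
  "g \<in> Lp_circle 2 \<longleftrightarrow> g \<in> borel_measurable dz \<and> integrable dz (\<lambda>z. (cmod (g z))\<^sup>2)"
  by (simp add: Lp_circle_def)

lemma L2_circle_imp_integrable:
  assumes "g \<in> Lp_circle 2"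
  shows "integrable dz g"
proof -
  interpret prob_space dz by (rule prob_space_dz)
  have m: "g \<in> borel_measurable dz" and i: "integrable dz (\<lambda>z. (cmod (g z))\<^sup>2)"
    using assms unfolding L2_circle_iff by simp_all
  have "integrable dz (\<lambda>z. cmod (g z))"
    by (rule square_integrable_imp_integrable[OF _ i]) (use m in measurable)
  then show ?thesis by (simp only: integrable_norm_iff[OF m])
qed

lemma cmod_diff_power2: "(cmod (a - b))\<^sup>2 = (cmod a)\<^sup>2 - 2 * Re (a * cnj b) + (cmod b)\<^sup>2"
  unfolding cmod_power2 by (simp add: power2_eq_square algebra_simps)

text \<open>With \<open>q\<close> the projection of \<open>g\<close> onto the span of the first \<open>N\<close> monomials, expand
  \<open>0 \<le> \<parallel>g - q\<parallel>\<^sup>2 = \<parallel>g\<parallel>\<^sup>2 - \<parallel>q\<parallel>\<^sup>2\<close>.\<close>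

lemma bessel_inequality:
  assumes g: "g \<in> Lp_circle 2"
  shows "(\<Sum>i<N. (cmod (\<integral>z. g z * cnj z ^ i \<partial>dz))\<^sup>2) \<le> (\<integral>z. (cmod (g z))\<^sup>2 \<partial>dz)"
proof (cases "N = 0")
  case False
  define c where "c = (\<lambda>i. \<integral>z. g z * cnj z ^ i \<partial>dz)"
  define q where "q = (\<Sum>i<N. monom (c i) i)"
  define B where "B = (\<Sum>i<N. (cmod (c i))\<^sup>2)"
  have int: "integrable dz g" by (rule L2_circle_imp_integrable[OF g])
  have int2: "integrable dz (\<lambda>z. (cmod (g z))\<^sup>2)" using g by (simp add: L2_circle_iff)
  have coeff_q: "coeff q i = (if i < N then c i else 0)" for i
    by (simp add: q_def coeff_sum)
  have "degree q \<le> N - 1" by (rule degree_le) (auto simp: coeff_q)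
  with False have deg: "degree q < N" by simp
  have "(\<integral>z. g z * cnj (poly q z) \<partial>dz) = (\<Sum>i\<le>degree q. cnj (coeff q i) * c i)"
    by (simp add: integral_times_cnj_poly[OF int] c_def)
  also have "\<dots> = (\<Sum>i<N. cnj (coeff q i) * c i)"
    using deg by (intro sum.mono_neutral_left) (auto simp: coeff_eq_0)
  also have "\<dots> = (\<Sum>i<N. complex_of_real ((cmod (c i))\<^sup>2))"
    by (intro sum.cong refl) (simp only: coeff_q lessThan_iff if_True complex_norm_square mult.commute)
  also have "\<dots> = complex_of_real B"
    by (simp only: B_def of_real_sum)
  finally have gq: "(\<integral>z. g z * cnj (poly q z) \<partial>dz) = complex_of_real B" .
  have "(\<integral>z. (cmod (poly q z))\<^sup>2 \<partial>dz) = (\<Sum>i<N. (cmod (coeff q i))\<^sup>2)"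
    unfolding parseval_poly using deg by (intro sum.mono_neutral_left) (auto simp: coeff_eq_0)
  then have qq: "(\<integral>z. (cmod (poly q z))\<^sup>2 \<partial>dz) = B" by (simp add: coeff_q B_def)
  have igq: "integrable dz (\<lambda>z. g z * cnj (poly q z))"
    by (intro integrable_dz_mult_continuous int continuous_on_cnj continuous_on_poly_complex)
  have "0 \<le> (\<integral>z. (cmod (g z - poly q z))\<^sup>2 \<partial>dz)" by simp
  also have "\<dots> = (\<integral>z. (cmod (g z))\<^sup>2 - 2 * Re (g z * cnj (poly q z)) + (cmod (poly q z))\<^sup>2 \<partial>dz)"
    by (simp only: cmod_diff_power2)
  also have "\<dots> = (\<integral>z. (cmod (g z))\<^sup>2 \<partial>dz) - 2 * B + B"
    using integrable_dz_norm_poly_power[of q 2] int2 igq gq qq integral_Re[OF igq]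
    by (simp del: times_complex.sel)
  finally show ?thesis by (simp add: B_def c_def)
qed auto

text \<open>The Cauchy--Schwarz inequality when one factor lies in the unit ball of \<open>L\<^sup>2\<close>: expand the
  square of \<open>g - B * f\<close>, where \<open>B\<close> is the integral of \<open>f * g\<close>.\<close>

lemma power2_integral_mult_le:
  fixes f g :: "'a \<Rightarrow> real"
  assumes "integrable M (\<lambda>x. (f x)\<^sup>2)" "integrable M (\<lambda>x. (g x)\<^sup>2)" "integrable M (\<lambda>x. f x * g x)"
    and "(\<integral>x. (f x)\<^sup>2 \<partial>M) \<le> 1"
  shows "(\<integral>x. f x * g x \<partial>M)\<^sup>2 \<le> (\<integral>x. (g x)\<^sup>2 \<partial>M)"
proof -
  define B where "B = (\<integral>x. f x * g x \<partial>M)"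
  have "0 \<le> (\<integral>x. (g x - B * f x)\<^sup>2 \<partial>M)" by simp
  also have "\<dots> = (\<integral>x. (g x)\<^sup>2 - 2 * B * (f x * g x) + B\<^sup>2 * (f x)\<^sup>2 \<partial>M)"
    by (simp add: power2_eq_square algebra_simps)
  also have "\<dots> = (\<integral>x. (g x)\<^sup>2 \<partial>M) - 2 * B * B + B\<^sup>2 * (\<integral>x. (f x)\<^sup>2 \<partial>M)"
    using assms by (simp add: B_def)
  also have "\<dots> \<le> (\<integral>x. (g x)\<^sup>2 \<partial>M) - 2 * B * B + B\<^sup>2 * 1"
    using assms(4) by (intro add_left_mono mult_left_mono) auto
  finally show ?thesis by (simp add: B_def power2_eq_square)
qed

section \<open>The derivative of the Poisson kernel\<close>

text \<open>For \<open>w = cis t\<close> this is \<open>- P' t / r\<close>, where \<open>P t = (1 - r\<^sup>2) / \<bar>1 - r * cis t\<bar>\<^sup>2\<close> is the Poisson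
  kernel: the kernel left after one integration by parts in a Poisson integral. It has the sign of
  \<open>Im w = sin t\<close>, so no absolute value is lost when it is paired with a multiple of \<open>\<bar>Im w\<bar>\<close>.\<close>

definition poisson_slope :: "real \<Rightarrow> complex \<Rightarrow> real" where
  "poisson_slope r w = 2 * (1 - r\<^sup>2) * Im w / cmod (1 - of_real r * w) ^ 4"

lemma one_minus_le_norm_one_minus:
  assumes "w \<in> circle" "0 \<le> r"
  shows "1 - r \<le> cmod (1 - of_real r * w)"
  using norm_triangle_ineq2[of 1 "of_real r * w"] assms by (simp add: circle_def norm_mult)

text \<open>Both \<open>w\<close> and \<open>1\<close> are compared with \<open>r * w\<close>, which is no farther from \<open>w\<close> than from \<open>1\<close>.
  Fourth powers of \<open>w - 1\<close> therefore absorb the denominator of the kernel.\<close>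

lemma norm_minus_one_le:
  assumes w: "w \<in> circle" and r: "0 \<le> r" "r < 1"
  shows "cmod (w - 1) \<le> 2 * cmod (1 - of_real r * w)"
proof -
  have "cmod (w - 1) \<le> cmod (of_real r * w - 1) + cmod (w - of_real r * w)"
    using norm_triangle_ineq[of "of_real r * w - 1" "w - of_real r * w"] by simp
  also have "w - of_real r * w = of_real (1 - r) * w" by (simp add: algebra_simps)
  also have "cmod (of_real (1 - r) * w) = 1 - r"
    unfolding norm_mult norm_of_real using w r by (simp add: circle_def)
  also have "cmod (of_real r * w - 1) = cmod (1 - of_real r * w)" by (rule norm_minus_commute)
  finally show ?thesis using one_minus_le_norm_one_minus[OF w r(1)] by linarith
qed

lemma continuous_on_poisson_slope:
  assumes "0 \<le> r" "r < 1"
  shows "continuous_on circle (poisson_slope r)"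
proof -
  have "cmod (1 - of_real r * w) ^ 4 \<noteq> 0" if "w \<in> circle" for w
    using one_minus_le_norm_one_minus[OF that assms(1)] assms(2) by auto
  then show ?thesis
    unfolding poisson_slope_def[abs_def] by (intro continuous_intros) auto
qed

text \<open>Differentiating the geometric series gives \<open>\<Sum>j. (j + 1) * x^j = 1 / (1 - x)\<^sup>2\<close>. Take \<open>x = r * cnj w\<close>
  and \<open>x = r * w\<close> and bring the difference over the common denominator \<open>\<bar>1 - r * w\<bar>\<^sup>4\<close>.\<close>

lemma poisson_slope_sums:
  assumes w: "w \<in> circle" and r: "0 \<le> r" "r < 1"
  shows "(\<lambda>j. \<i> * of_nat (Suc j) * of_real r ^ j * (cnj w ^ Suc j - w ^ Suc j)) sums
    of_real (poisson_slope r w)"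
proof -
  define d where "d = 1 - of_real r * w"
  have n: "cmod (of_real r * w) < 1" "cmod (of_real r * cnj w) < 1"
    using w r by (simp_all add: circle_def norm_mult)
  have d0: "d \<noteq> 0" using n(1) by (auto simp: d_def)
  have cd: "1 - of_real r * cnj w = cnj d" by (simp add: d_def)
  have cd0: "cnj d \<noteq> 0" using d0 by simp
  have u: "w * cnj w = 1"
    using w by (simp add: circle_def complex_norm_square[symmetric])
  have "(\<lambda>j. \<i> * cnj w * (of_nat (Suc j) * (of_real r * cnj w) ^ j) -
      \<i> * w * (of_nat (Suc j) * (of_real r * w) ^ j)) sums
    (\<i> * cnj w * (1 / (1 - of_real r * cnj w)\<^sup>2) - \<i> * w * (1 / (1 - of_real r * w)\<^sup>2))"
    by (intro sums_diff sums_mult geometric_deriv_sums n)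
  also have "\<i> * cnj w * (1 / (1 - of_real r * cnj w)\<^sup>2) - \<i> * w * (1 / (1 - of_real r * w)\<^sup>2) =
      \<i> * (cnj w * d\<^sup>2 - w * (cnj d)\<^sup>2) / (d * cnj d)\<^sup>2"
    unfolding cd d_def[symmetric] using d0 cd0 by (simp add: field_simps)
  also have "cnj w * d\<^sup>2 - w * (cnj d)\<^sup>2 =
      (1 - of_real r ^ 2 * (w * cnj w)) * (cnj w - w)"
    by (simp add: d_def power2_eq_square algebra_simps)
  also have "cnj w - w = - 2 * \<i> * of_real (Im w)"
    by (simp add: complex_eq_iff)
  also have "(d * cnj d)\<^sup>2 = of_real (cmod d ^ 4)"
    by (simp add: complex_norm_square[symmetric] del: complex_mult_cnj)
  also have "\<i> * ((1 - of_real r ^ 2 * (w * cnj w)) * (- 2 * \<i> * of_real (Im w))) / of_real (cmod d ^ 4) =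
      of_real (poisson_slope r w)"
    by (simp add: u poisson_slope_def d_def algebra_simps)
  finally show ?thesis
    by (simp add: power_mult_distrib algebra_simps)
qed

text \<open>By orthogonality only the term with \<open>j + 1 = n\<close> of the series of the kernel survives. So integrating
  against the kernel differentiates a monomial and evaluates it at \<open>r\<close>, up to the factor \<open>\<i>\<close>.\<close>

lemma integral_power_poisson_slope:
  assumes r: "0 \<le> r" "r < 1"
  shows "(\<integral>w. w ^ n * of_real (poisson_slope r w) \<partial>dz) = \<i> * of_nat n * of_real r ^ (n - 1)"
proof -
  define h where "h = (\<lambda>j w. \<i> * of_nat (Suc j) * of_real r ^ j * (w ^ n * cnj w ^ Suc j - w ^ (n + Suc j)) :: complex)"
  have h_sums: "(\<lambda>j. h j w) sums (w ^ n * of_real (poisson_slope r w))" if "w \<in> circle" for w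
    using sums_mult[OF poisson_slope_sums[OF that r], of "w ^ n"]
    by (simp add: h_def algebra_simps power_add)
  have int_h: "integrable dz (h j)" for j
    unfolding h_def by (intro integrable_dz_continuous continuous_intros)
  have norm_h: "cmod (h j w) \<le> 2 * (of_nat (Suc j) * r ^ j)" if "w \<in> circle" for j w
  proof -
    have "cmod (w ^ n * cnj w ^ Suc j - w ^ (n + Suc j)) \<le> 1 + 1"
      by (rule order_trans[OF norm_triangle_ineq4])
         (use that in \<open>simp add: norm_mult norm_power circle_def\<close>)
    then have "(of_nat (Suc j) * r ^ j) * cmod (w ^ n * cnj w ^ Suc j - w ^ (n + Suc j)) \<le> (of_nat (Suc j) * r ^ j) * 2"
      using r by (intro mult_left_mono) auto
    moreover have "cmod (h j w) = (of_nat (Suc j) * r ^ j) * cmod (w ^ n * cnj w ^ Suc j - w ^ (n + Suc j))"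
      unfolding h_def norm_mult norm_power norm_of_real norm_of_nat using r by simp
    ultimately show ?thesis by simp
  qed
  have summ: "summable (\<lambda>j. 2 * (of_nat (Suc j) * r ^ j))"
    using geometric_deriv_sums[of r] r by (intro summable_mult) (simp add: sums_iff)
  have "(\<lambda>j. \<integral>w. h j w \<partial>dz) sums (\<integral>w. (\<Sum>j. h j w) \<partial>dz)"
  proof (rule sums_integral[OF int_h])
    show "AE w in dz. summable (\<lambda>j. norm (h j w))"
      by (rule AE_I2) (rule summable_comparison_test'[OF summ], use norm_h in auto)
    show "summable (\<lambda>j. \<integral>w. norm (h j w) \<partial>dz)"
    proof (rule summable_comparison_test'[OF summ])
      fix j :: nat
      interpret prob_space dz by (rule prob_space_dz)
      have "(\<integral>w. norm (h j w) \<partial>dz) \<le> 2 * (of_nat (Suc j) * r ^ j)"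
        by (rule integral_le_const) (use int_h norm_h in \<open>auto intro!: AE_I2\<close>)
      then show "norm (\<integral>w. norm (h j w) \<partial>dz) \<le> 2 * (of_nat (Suc j) * r ^ j)" by simp
    qed
  qed
  moreover have "(\<integral>w. (\<Sum>j. h j w) \<partial>dz) = (\<integral>w. w ^ n * of_real (poisson_slope r w) \<partial>dz)"
    by (intro Bochner_Integration.integral_cong refl) (use h_sums in \<open>simp add: sums_iff\<close>)
  moreover have "(\<integral>w. h j w \<partial>dz) = (if Suc j = n then \<i> * of_nat n * of_real r ^ (n - 1) else 0)" for j
  proof -
    have "(\<integral>w. h j w \<partial>dz) = \<i> * of_nat (Suc j) * of_real r ^ j *
       ((\<integral>w. w ^ n * cnj w ^ Suc j \<partial>dz) - (\<integral>w. w ^ (n + Suc j) \<partial>dz))"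
    proof -
      have "integrable dz (\<lambda>w. w ^ n * cnj w ^ Suc j)" "integrable dz (\<lambda>w::complex. w ^ (n + Suc j))"
        by (intro integrable_dz_continuous continuous_intros)+
      then show ?thesis
        unfolding h_def by (simp only: integral_mult_right_zero Bochner_Integration.integral_diff)
    qed
    then show ?thesis unfolding integral_dz_power_cnj_power integral_dz_power by auto
  qed
  moreover have "(\<lambda>j. if Suc j = n then \<i> * of_nat n * of_real r ^ (n - 1) else 0) sums
      (\<i> * of_nat n * of_real r ^ (n - 1))"
  proof (cases n)
    case (Suc m)
    then show ?thesis using sums_single[of m "\<lambda>_. \<i> * of_nat n * of_real r ^ (n - 1)"] by simp
  qed simp
  ultimately show ?thesis by (simp add: sums_iff)
qed

definition primitive :: "complex poly \<Rightarrow> complex \<Rightarrow> complex" where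
  "primitive p w = (\<Sum>n\<le>degree p. coeff p n / of_nat (Suc n) * w ^ Suc n)"

lemma continuous_on_primitive: "continuous_on A (primitive p)"
  unfolding primitive_def by (intro continuous_intros)

lemma integral_primitive_poisson_slope:
  assumes r: "0 \<le> r" "r < 1"
  shows "(\<integral>w. primitive p (z * w) * of_real (poisson_slope r w) \<partial>dz) = \<i> * z * poly p (of_real r * z)"
proof -
  have c: "continuous_on circle (\<lambda>w. complex_of_real (poisson_slope r w))"
    by (intro continuous_on_of_real continuous_on_poisson_slope r)
  have "(\<integral>w. primitive p (z * w) * of_real (poisson_slope r w) \<partial>dz) =
      (\<integral>w. (\<Sum>n\<le>degree p. (coeff p n / of_nat (Suc n) * z ^ Suc n) * (w ^ Suc n * of_real (poisson_slope r w))) \<partial>dz)"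
    unfolding primitive_def sum_distrib_right
    by (intro Bochner_Integration.integral_cong sum.cong refl) (simp add: power_mult_distrib)
  also have "\<dots> = (\<Sum>n\<le>degree p. (coeff p n / of_nat (Suc n) * z ^ Suc n) *
      (\<integral>w. w ^ Suc n * of_real (poisson_slope r w) \<partial>dz))"
    unfolding integral_mult_right_zero[symmetric]
    by (rule Bochner_Integration.integral_sum)
       (intro integrable_dz_continuous continuous_on_mult c continuous_on_power continuous_on_id
          continuous_on_const)
  also have "\<dots> = (\<Sum>n\<le>degree p. \<i> * z * (coeff p n * (of_real r * z) ^ n))"
  proof (rule sum.cong[OF refl])
    fix n
    have "of_nat (Suc n) \<noteq> (0::complex)" by (rule of_nat_neq_0)
    then show "(coeff p n / of_nat (Suc n) * z ^ Suc n) *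
        (\<integral>w. w ^ Suc n * of_real (poisson_slope r w) \<partial>dz) = \<i> * z * (coeff p n * (of_real r * z) ^ n)"
      unfolding integral_power_poisson_slope[OF r]
      by (simp add: power_mult_distrib del: of_nat_Suc)
  qed
  also have "\<dots> = \<i> * z * poly p (of_real r * z)"
    by (simp add: poly_altdef sum_distrib_left)
  finally show ?thesis .
qed

text \<open>The quantitative core of Fatou's theorem. If the primitive of \<open>p\<close> is approximately linear at \<open>z\<close>,
  with slope \<open>A\<close> in the variable \<open>\<i> * Im w\<close>, then \<open>z * p (r * z)\<close> is close to \<open>A\<close>.

  Integrating the deviation from linearity against the kernel produces exactly \<open>\<i> * (z * p (r * z) - A)\<close>,
  because the kernel annihilates constants and \<open>Im w\<close> has integral \<open>1\<close> against it. The three terms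
  of the hypothesis are treated separately: the part \<open>\<bar>Im w\<bar>\<close> costs the same integral \<open>1\<close>, by the sign
  of the kernel; the uniform error \<open>\<eta>\<close> costs the maximum of the kernel, which does not matter since it is
  sent to \<open>0\<close> for fixed \<open>r\<close>; and the quartic term, which takes care of \<open>w\<close> far from \<open>1\<close>, cancels the
  denominator of the kernel and leaves a multiple of \<open>1 - r\<^sup>2\<close>.\<close>

lemma radial_value_estimate:
  assumes z: "z \<in> circle" and r: "0 \<le> r" "r < 1" and nn: "0 \<le> \<epsilon>" "0 \<le> \<eta>" "0 \<le> C"
    and bound: "\<And>w. w \<in> circle \<Longrightarrow>
      cmod (primitive p (z * w) - primitive p z - A * \<i> * of_real (Im w)) \<le> \<epsilon> * \<bar>Im w\<bar> + \<eta> + C * cmod (w - 1) ^ 4"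
  shows "cmod (z * poly p (of_real r * z) - A) \<le>
    \<epsilon> + \<eta> * (2 * (1 - r\<^sup>2) / (1 - r) ^ 4) + C * (32 * (1 - r\<^sup>2))"
proof -
  interpret prob_space dz by (rule prob_space_dz)
  let ?k = "poisson_slope r"
  have ck: "continuous_on circle ?k" by (rule continuous_on_poisson_slope[OF r])
  then have ck': "continuous_on circle (\<lambda>w. complex_of_real (?k w))" by (rule continuous_on_of_real)
  have cp: "continuous_on circle (\<lambda>w. primitive p (z * w))"
    by (rule continuous_on_circle_rotate[OF continuous_on_primitive z])
  have cI: "continuous_on circle (\<lambda>w. complex_of_real (Im w))" "continuous_on circle Im"
    by (intro continuous_intros)+
  have r2: "0 \<le> 1 - r\<^sup>2" using r by (simp add: power_le_one)
  have k0: "(\<integral>w. of_real (?k w) \<partial>dz) = (0 :: complex)"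
    using integral_power_poisson_slope[OF r, of 0] by simp
  have k1: "(\<integral>w. w * of_real (?k w) \<partial>dz) = \<i>"
    using integral_power_poisson_slope[OF r, of 1] by simp
  have i1: "integrable dz (\<lambda>w. w * complex_of_real (?k w))"
    by (intro integrable_dz_continuous continuous_on_mult ck' continuous_on_id)
  have kIm: "(\<integral>w. Im w * ?k w \<partial>dz) = 1"
    using integral_Im[OF i1] k1 by simp
  have kImc: "(\<integral>w. of_real (Im w) * of_real (?k w) \<partial>dz) = (1::complex)"
    using integral_complex_of_real[of dz "\<lambda>w. Im w * ?k w"] kIm by simp
  have "(\<integral>w. (primitive p (z * w) - primitive p z - A * \<i> * of_real (Im w)) * of_real (?k w) \<partial>dz) =
     (\<integral>w. primitive p (z * w) * of_real (?k w) - primitive p z * of_real (?k w)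
        - (A * \<i>) * (of_real (Im w) * of_real (?k w)) \<partial>dz)"
    by (simp add: algebra_simps)
  also have "\<dots> = \<i> * z * poly p (of_real r * z) - primitive p z * 0 - (A * \<i>) * 1"
    unfolding kImc[symmetric] k0[symmetric] integral_primitive_poisson_slope[OF r, symmetric]
    by (subst Bochner_Integration.integral_diff Bochner_Integration.integral_diff integral_mult_right,
        (intro Bochner_Integration.integrable_diff integrable_mult_right integrable_dz_continuous continuous_on_mult cp ck' cI continuous_on_const)+)+
       simp
  finally have eq: "(\<integral>w. (primitive p (z * w) - primitive p z - A * \<i> * of_real (Im w)) * of_real (?k w) \<partial>dz)
     = \<i> * (z * poly p (of_real r * z) - A)" by (simp add: algebra_simps)
  define B where "B = 2 * (1 - r\<^sup>2) / (1 - r) ^ 4"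
  have "cmod (z * poly p (of_real r * z) - A) =
     cmod (\<integral>w. (primitive p (z * w) - primitive p z - A * \<i> * of_real (Im w)) * of_real (?k w) \<partial>dz)"
    unfolding eq by (simp add: norm_mult)
  also have "\<dots> \<le> (\<integral>w. cmod ((primitive p (z * w) - primitive p z - A * \<i> * of_real (Im w)) * of_real (?k w)) \<partial>dz)"
    by (rule integral_norm_bound)
  also have "\<dots> \<le> (\<integral>w. \<epsilon> * (Im w * ?k w) + (\<eta> * B + C * (32 * (1 - r\<^sup>2))) \<partial>dz)"
  proof (rule integral_mono)
    show "integrable dz (\<lambda>w. cmod ((primitive p (z * w) - primitive p z - A * \<i> * of_real (Im w)) * of_real (?k w)))"
      by (intro integrable_dz_continuous continuous_on_norm continuous_on_mult continuous_on_diff cp ck' cI continuous_on_const)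
    show "integrable dz (\<lambda>w. \<epsilon> * (Im w * ?k w) + (\<eta> * B + C * (32 * (1 - r\<^sup>2))))"
      by (intro integrable_dz_continuous continuous_on_add continuous_on_mult ck cI continuous_on_const)
    fix w assume "w \<in> space dz"
    then have w: "w \<in> circle" by simp
    define D where "D = cmod (1 - of_real r * w)"
    have D: "1 - r \<le> D" "0 < D" "cmod (w - 1) \<le> 2 * D"
      using one_minus_le_norm_one_minus[OF w r(1)] norm_minus_one_le[OF w r] r(2) by (auto simp: D_def)
    have absk: "\<bar>?k w\<bar> = 2 * (1 - r\<^sup>2) * \<bar>Im w\<bar> / D ^ 4"
      using r2 by (simp add: poisson_slope_def D_def abs_mult)
    have "\<bar>Im w\<bar> \<le> 1" using abs_Im_le_cmod[of w] w by (simp add: circle_def)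
    then have absk': "\<bar>?k w\<bar> \<le> 2 * (1 - r\<^sup>2) / D ^ 4"
      unfolding absk using r2 D by (intro divide_right_mono mult_left_le) auto
    have kI: "\<bar>Im w\<bar> * \<bar>?k w\<bar> = Im w * ?k w"
      unfolding absk using r2 by (simp add: poisson_slope_def D_def)
    have "(1 - r) ^ 4 \<le> D ^ 4" using D r by (intro power_mono) auto
    then have kB: "\<bar>?k w\<bar> \<le> B"
      unfolding B_def using r2 r D
      by (intro order_trans[OF absk'] divide_left_mono mult_pos_pos zero_less_power) auto
    have "cmod (w - 1) ^ 4 \<le> (2 * D) ^ 4" using D by (intro power_mono) auto
    then have "cmod (w - 1) ^ 4 * \<bar>?k w\<bar> \<le> (2 * D) ^ 4 * (2 * (1 - r\<^sup>2) / D ^ 4)"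
      using absk' D by (intro mult_mono) auto
    also have "\<dots> = 32 * (1 - r\<^sup>2)" using D by (simp add: power_mult_distrib)
    finally have kfar: "cmod (w - 1) ^ 4 * \<bar>?k w\<bar> \<le> 32 * (1 - r\<^sup>2)" .
    have "cmod ((primitive p (z * w) - primitive p z - A * \<i> * of_real (Im w)) * of_real (?k w)) \<le>
        (\<epsilon> * \<bar>Im w\<bar> + \<eta> + C * cmod (w - 1) ^ 4) * \<bar>?k w\<bar>"
      unfolding norm_mult norm_of_real by (intro mult_right_mono bound w) auto
    also have "\<dots> = \<epsilon> * (\<bar>Im w\<bar> * \<bar>?k w\<bar>) + (\<eta> * \<bar>?k w\<bar> + C * (cmod (w - 1) ^ 4 * \<bar>?k w\<bar>))"
      by (simp add: algebra_simps)
    also have "\<dots> \<le> \<epsilon> * (Im w * ?k w) + (\<eta> * B + C * (32 * (1 - r\<^sup>2)))"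
      unfolding kI using kB kfar nn by (intro add_left_mono add_mono mult_left_mono) auto
    finally show "cmod ((primitive p (z * w) - primitive p z - A * \<i> * of_real (Im w)) * of_real (?k w)) \<le>
      \<epsilon> * (Im w * ?k w) + (\<eta> * B + C * (32 * (1 - r\<^sup>2)))" .
  qed
  also have "\<dots> = \<epsilon> + (\<eta> * B + C * (32 * (1 - r\<^sup>2)))"
  proof -
    have "integrable dz (\<lambda>w. \<epsilon> * (Im w * ?k w))"
      by (intro integrable_dz_continuous continuous_on_mult ck cI continuous_on_const)
    then have "(\<integral>w. \<epsilon> * (Im w * ?k w) + (\<eta> * B + C * (32 * (1 - r\<^sup>2))) \<partial>dz) =
       (\<integral>w. \<epsilon> * (Im w * ?k w) \<partial>dz) + (\<integral>w. (\<eta> * B + C * (32 * (1 - r\<^sup>2))) \<partial>dz)"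
      by (rule Bochner_Integration.integral_add) simp
    then show ?thesis using prob_space by (simp add: kIm del: space_dz)
  qed
  finally show ?thesis by (simp add: B_def)
qed

section \<open>Lebesgue points and the angular parametrization\<close>

text \<open>Lebesgue differentiation of the indefinite integral from the right is
  \<open>integrable_ccontinuous_explicit\<close>; the statement from the left is the same for the reflected function.\<close>

lemma lebesgue_two_sided_point:
  fixes g :: "real \<Rightarrow> 'a::euclidean_space"
  assumes g: "\<And>a b. g integrable_on {a..b}"
  obtains N where "negligible N"
    "\<And>x e. x \<notin> N \<Longrightarrow> 0 < e \<Longrightarrow> \<exists>d>0. \<forall>h. 0 \<le> h \<and> h < d \<longrightarrow>
       norm (integral {x..x + h} g - h *\<^sub>R g x) \<le> e * h \<and>
       norm (integral {x - h..x} g - h *\<^sub>R g x) \<le> e * h"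
proof -
  have one_sided: "\<exists>N. negligible N \<and> (\<forall>x e. x \<notin> N \<longrightarrow> 0 < e \<longrightarrow>
      (\<exists>d>0. \<forall>h. 0 \<le> h \<and> h < d \<longrightarrow> norm (integral {x..x + h} k - h *\<^sub>R k x) \<le> e * h))"
    if k: "\<And>a b. k integrable_on {a..b}" for k :: "real \<Rightarrow> 'a"
  proof -
    obtain N where N: "negligible N" and *: "\<And>x e. x \<notin> N \<Longrightarrow> 0 < e \<Longrightarrow>
        \<exists>d>0. \<forall>h. 0 < h \<and> h < d \<longrightarrow>
          norm (integral (cbox x (x + h *\<^sub>R One)) k /\<^sub>R h ^ DIM(real) - k x) < e"
      using integrable_ccontinuous_explicit[of k] k by auto
    have "\<exists>d>0. \<forall>h. 0 \<le> h \<and> h < d \<longrightarrow> norm (integral {x..x + h} k - h *\<^sub>R k x) \<le> e * h"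
      if xe: "x \<notin> N" "0 < e" for x e
    proof -
      obtain d where d: "d > 0" "\<And>h. 0 < h \<Longrightarrow> h < d \<Longrightarrow> norm (integral {x..x + h} k /\<^sub>R h - k x) < e"
        using *[OF xe] by auto
      have "norm (integral {x..x + h} k - h *\<^sub>R k x) \<le> e * h" if h: "0 \<le> h" "h < d" for h
      proof (cases "h = 0")
        case False
        then have "h > 0" using h by simp
        have "integral {x..x + h} k - h *\<^sub>R k x = h *\<^sub>R (integral {x..x + h} k /\<^sub>R h - k x)"
          using \<open>h > 0\<close> by (simp add: scaleR_diff_right)
        then have "norm (integral {x..x + h} k - h *\<^sub>R k x) = h * norm (integral {x..x + h} k /\<^sub>R h - k x)"
          using \<open>h > 0\<close> by simp
        also have "\<dots> \<le> h * e" using d(2)[OF \<open>h > 0\<close> h(2)] \<open>h > 0\<close> by (intro mult_left_mono) auto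
        finally show ?thesis by (simp add: mult.commute)
      qed simp
      then show ?thesis using d(1) by blast
    qed
    then show ?thesis using N by blast
  qed
  obtain N1 where N1: "negligible N1" "\<And>x e. x \<notin> N1 \<Longrightarrow> 0 < e \<Longrightarrow>
      \<exists>d>0. \<forall>h. 0 \<le> h \<and> h < d \<longrightarrow> norm (integral {x..x + h} g - h *\<^sub>R g x) \<le> e * h"
    using one_sided[OF g] by blast
  have g': "(\<lambda>x. g (- x)) integrable_on {a..b}" for a b
    using iffD2[OF Henstock_Kurzweil_Integration.integrable_reflect_real[where f=g and a="- b" and b="- a"], OF g]
    by (simp only: minus_minus)
  obtain N2 where N2: "negligible N2" "\<And>x e. x \<notin> N2 \<Longrightarrow> 0 < e \<Longrightarrow>
      \<exists>d>0. \<forall>h. 0 \<le> h \<and> h < d \<longrightarrow> norm (integral {x..x + h} (\<lambda>x. g (- x)) - h *\<^sub>R g (- x)) \<le> e * h"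
    using one_sided[OF g'] by blast
  show ?thesis
  proof (rule that[of "N1 \<union> uminus ` N2"])
    have "linear (uminus :: real \<Rightarrow> real)" by (simp add: linear_uminus)
    then show "negligible (N1 \<union> uminus ` N2)"
      by (intro negligible_Un N1 negligible_differentiable_image_negligible[OF order_refl]
          linear_imp_differentiable_on N2)
    fix x e :: real assume x: "x \<notin> N1 \<union> uminus ` N2" and e: "0 < e"
    then have x2: "- x \<notin> N2" by force
    obtain d1 where d1: "d1 > 0" "\<And>h. 0 \<le> h \<Longrightarrow> h < d1 \<Longrightarrow> norm (integral {x..x + h} g - h *\<^sub>R g x) \<le> e * h"
      using N1(2)[of x e] x e by blast
    obtain d2 where d2: "d2 > 0" "\<And>h. 0 \<le> h \<Longrightarrow> h < d2 \<Longrightarrow>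
        norm (integral {- x..- x + h} (\<lambda>x. g (- x)) - h *\<^sub>R g (- (- x))) \<le> e * h"
      using N2(2)[OF x2 e] by blast
    have "integral {- x..- x + h} (\<lambda>x. g (- x)) = integral {x - h..x} g" for h
      using Henstock_Kurzweil_Integration.integral_reflect_real[where f=g and b=x and a="x - h"] by simp
    then show "\<exists>d>0. \<forall>h. 0 \<le> h \<and> h < d \<longrightarrow>
       norm (integral {x..x + h} g - h *\<^sub>R g x) \<le> e * h \<and>
       norm (integral {x - h..x} g - h *\<^sub>R g x) \<le> e * h"
      using d1 d2 by (intro exI[of _ "min d1 d2"]) simp
  qed
qed

text \<open>The argument jumps at \<open>1\<close> and is continuous elsewhere on the circle.\<close>

lemma measurable_Arg2pi_circle: "Arg2pi \<in> borel_measurable circle_borel"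
proof (rule measurable_piecewise_restrict[of "{{1}, - {1}}"])
  fix A :: "complex set" assume A: "A \<in> {{1}, - {1}}"
  have Am: "A \<in> sets borel" using A by auto
  then show "A \<inter> space circle_borel \<in> sets circle_borel"
    by (subst Int_commute) (simp add: circle_borel_def sets_restrict_space space_restrict_space)
  have "continuous_on (circle \<inter> A) Arg2pi"
  proof (cases "A = {1}")
    case True
    show ?thesis unfolding True by (rule continuous_on_subset[OF continuous_on_sing]) (rule Int_lower2)
  next
    case False
    then have "A = - {1}" using A by simp
    have "z \<notin> \<real>\<^sub>\<ge>\<^sub>0" if z: "z \<in> circle \<inter> A" for z
    proof
      assume "z \<in> \<real>\<^sub>\<ge>\<^sub>0"
      then obtain x where "z = of_real x" "0 \<le> x" by (rule nonneg_Reals_cases)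
      then have "z = 1" using z by (simp add: circle_def)
      then show False using z \<open>A = - {1}\<close> by simp
    qed
    then show ?thesis
      by (intro continuous_at_imp_continuous_on ballI continuous_at_Arg2pi)
  qed
  then have "Arg2pi \<in> borel_measurable (restrict_space borel (circle \<inter> A))"
    by (rule borel_measurable_continuous_on_restrict)
  then show "Arg2pi \<in> borel_measurable (restrict_space circle_borel A)"
    unfolding circle_borel_def using Am
    by (subst restrict_restrict_space) (simp_all add: circle_def)
qed auto

lemma cis_Arg2pi_circle: "z \<in> circle \<Longrightarrow> cis (Arg2pi z) = z"
  using Arg2pi_eq[of z] by (simp add: circle_def cis_conv_exp)

lemma Arg2pi_cis: "0 \<le> t \<Longrightarrow> t < 2 * pi \<Longrightarrow> Arg2pi (cis t) = t"
  using Arg2pi_unique[of 1 t "cis t"] by (simp add: cis_conv_exp)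

text \<open>The image of a null set of angles need not be measurable. The exceptional set is therefore enlarged
  to a Borel null set containing both end points, whose image is the preimage of a Borel set under
  the measurable argument.\<close>

lemma AE_dz_from_angle:
  assumes N: "negligible N"
    and P: "\<And>t. 0 < t \<Longrightarrow> t < 2 * pi \<Longrightarrow> t \<notin> N \<Longrightarrow> P (cis t)"
  shows "AE z in dz. P z"
proof -
  have "AE t in lebesgue. t \<notin> N"
    using N unfolding negligible_iff_null_sets by (rule AE_not_in)
  then have "AE t in lborel. t \<notin> N"
    by (simp add: AE_completion_iff)
  then obtain N' where N': "N' \<in> null_sets lborel" "N \<subseteq> N'"
    by (elim AE_E3) auto
  \<comment> \<open>the end points are added because \<open>Arg2pi\<close> inverts \<open>cis\<close> only below \<open>2 * pi\<close>\<close>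
  define X where "X = N' \<union> {0, 2*pi}"
  have X: "X \<in> null_sets lborel"
    unfolding X_def by (intro null_sets.Un N') (simp add: finite_imp_null_set_lborel)
  then have Xm: "X \<in> sets borel" by auto
  have m: "Measurable.pred circle_borel (\<lambda>z. Arg2pi z \<notin> X)"
    using measurable_Arg2pi_circle Xm by measurable
  have c: "cis \<in> (density lborel (\<lambda>t. ennreal (indicator {0..2*pi} t / (2*pi)))) \<rightarrow>\<^sub>M circle_borel"
    using measurable_cis_circle by simp
  have "AE t in lborel. t \<notin> X" by (rule AE_not_in[OF X])
  then have "AE t in density lborel (\<lambda>t. ennreal (indicator {0..2*pi} t / (2*pi))). Arg2pi (cis t) \<notin> X"
  proof (subst AE_density)
    assume "AE t in lborel. t \<notin> X"
    then show "AE t in lborel. 0 < ennreal (indicator {0..2*pi} t / (2*pi)) \<longrightarrow> Arg2pi (cis t) \<notin> X"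
    proof eventually_elim
      case (elim t)
      then have "t \<noteq> 2 * pi" by (simp add: X_def)
      with elim show ?case by (auto simp: indicator_def Arg2pi_cis)
    qed
  qed simp
  then have "AE z in dz. Arg2pi z \<notin> X"
    unfolding dz_eq_distr_density using m by (subst AE_distr_iff[OF c]) (auto simp: pred_def)
  then show ?thesis
  proof (rule AE_mp, intro AE_I2 impI)
    fix z assume z: "z \<in> space dz" and "Arg2pi z \<notin> X"
    then have "0 < Arg2pi z" "Arg2pi z \<notin> N"
      using Arg2pi_ge_0[of z] N'(2) by (auto simp: X_def less_le)
    from P[OF this(1) Arg2pi_lt_2pi this(2)] show "P z"
      using z by (simp add: cis_Arg2pi_circle)
  qed
qed

lemma primitive_cis_diff:
  assumes "a \<le> b"
  shows "((\<lambda>s. \<i> * cis s * poly p (cis s)) has_integral (primitive p (cis b) - primitive p (cis a))) {a..b}"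
proof (rule fundamental_theorem_of_calculus[OF assms])
  fix s
  have 1: "(primitive p has_field_derivative poly p w) (at w)" for w
  proof -
    have "(primitive p has_field_derivative (\<Sum>n\<le>degree p. coeff p n / of_nat (Suc n) * (of_nat (Suc n) * w ^ n))) (at w)"
      unfolding primitive_def[abs_def]
    proof (rule DERIV_sum)
      fix n
      have "((\<lambda>w. w ^ Suc n) has_field_derivative of_nat (Suc n) * w ^ n) (at w)"
        using DERIV_power_Suc[OF DERIV_ident, of n w UNIV] by simp
      then show "((\<lambda>w. coeff p n / of_nat (Suc n) * w ^ Suc n) has_field_derivative
          coeff p n / of_nat (Suc n) * (of_nat (Suc n) * w ^ n)) (at w)"
        by (rule DERIV_cmult)
    qed
    also have "(\<Sum>n\<le>degree p. coeff p n / of_nat (Suc n) * (of_nat (Suc n) * w ^ n)) = poly p w"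
      unfolding poly_altdef by (intro sum.cong refl) (simp del: of_nat_Suc)
    finally show ?thesis .
  qed
  have 2: "(cis has_vector_derivative \<i> * cis s) (at s within {a..b})"
    unfolding cis_conv_exp
    by (rule has_vector_derivative_real_field[of "\<lambda>z. exp (\<i> * z)"])
       (auto intro!: derivative_eq_intros)
  show "((\<lambda>x. primitive p (cis x)) has_vector_derivative \<i> * cis s * poly p (cis s)) (at s within {a..b})"
    using field_vector_diff_chain_within[OF 2 has_field_derivative_at_within[OF 1]]
    by (simp add: o_def)
qed

section \<open>Radial limits of the analytic extension\<close>

definition fourier_coeff :: "(complex \<Rightarrow> complex) \<Rightarrow> nat \<Rightarrow> complex" where
  "fourier_coeff f k = (\<integral>z. f z * cnj z ^ k \<partial>dz)"

text \<open>For \<open>f\<close> an \<open>L\<^sup>1\<close> limit of polynomials the negative Fourier coefficients vanish, and this power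
  series is the Poisson integral of \<open>f\<close>.\<close>

definition hardy_extension :: "(complex \<Rightarrow> complex) \<Rightarrow> complex \<Rightarrow> complex" where
  "hardy_extension f w = (\<Sum>k. fourier_coeff f k * w ^ k)"

lemma integrable_times_cnj_power:
  "integrable dz f \<Longrightarrow> integrable dz (\<lambda>z. f z * cnj z ^ k)"
  by (intro integrable_dz_mult_continuous continuous_on_power continuous_on_cnj continuous_on_id)

lemma norm_fourier_coeff_le:
  assumes "integrable dz f"
  shows "cmod (fourier_coeff f k) \<le> (\<integral>z. cmod (f z) \<partial>dz)"
proof -
  have "cmod (fourier_coeff f k) \<le> (\<integral>z. cmod (f z * cnj z ^ k) \<partial>dz)"
    unfolding fourier_coeff_def by (rule integral_norm_bound)
  also have "\<dots> = (\<integral>z. cmod (f z) \<partial>dz)"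
    by (intro Bochner_Integration.integral_cong refl) (simp add: norm_mult norm_power circle_def)
  finally show ?thesis .
qed

lemma fourier_coeff_poly: "fourier_coeff (poly p) k = coeff p k"
  by (simp add: fourier_coeff_def integral_poly_cnj_power)

lemma fourier_coeff_diff:
  assumes "integrable dz f" "integrable dz g"
  shows "fourier_coeff (\<lambda>z. f z - g z) k = fourier_coeff f k - fourier_coeff g k"
  using integrable_times_cnj_power[OF assms(1), of k] integrable_times_cnj_power[OF assms(2), of k]
  by (simp add: fourier_coeff_def left_diff_distrib)

lemma hardy_extension_sums:
  assumes f: "integrable dz f" and w: "cmod w < 1"
  shows "(\<lambda>k. fourier_coeff f k * w ^ k) sums hardy_extension f w"
    and "cmod (hardy_extension f w) \<le> (\<integral>z. cmod (f z) \<partial>dz) / (1 - cmod w)"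
proof -
  define M where "M = (\<integral>z. cmod (f z) \<partial>dz)"
  have b: "cmod (fourier_coeff f k * w ^ k) \<le> M * cmod w ^ k" for k
    unfolding norm_mult norm_power M_def by (intro mult_right_mono norm_fourier_coeff_le f) auto
  have s: "(\<lambda>k. M * cmod w ^ k) sums (M * (1 / (1 - cmod w)))"
    by (intro sums_mult geometric_sums) (use w in simp)
  have sn: "summable (\<lambda>k. cmod (fourier_coeff f k * w ^ k))"
    by (rule summable_comparison_test'[OF sums_summable[OF s]]) (use b in simp)
  show "(\<lambda>k. fourier_coeff f k * w ^ k) sums hardy_extension f w"
    unfolding hardy_extension_def by (rule summable_sums[OF summable_norm_cancel[OF sn]])
  have "cmod (hardy_extension f w) \<le> (\<Sum>k. cmod (fourier_coeff f k * w ^ k))"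
    unfolding hardy_extension_def by (rule summable_norm[OF sn])
  also have "\<dots> \<le> (\<Sum>k. M * cmod w ^ k)"
    by (intro suminf_le b sn sums_summable[OF s])
  also have "\<dots> = M / (1 - cmod w)" using s by (simp add: sums_iff)
  finally show "cmod (hardy_extension f w) \<le> M / (1 - cmod w)" .
qed

lemma holomorphic_hardy_extension:
  assumes "integrable dz f"
  shows "hardy_extension f holomorphic_on ball 0 1"
  by (rule power_series_holomorphic[of _ _ "fourier_coeff f"])
     (use hardy_extension_sums(1)[OF assms] in simp)

lemma hardy_extension_poly:
  assumes "cmod w < 1"
  shows "hardy_extension (poly p) w = poly p w"
proof -
  have "(\<lambda>k. coeff p k * w ^ k) sums (\<Sum>k\<le>degree p. coeff p k * w ^ k)"
    by (rule sums_finite) (auto simp: coeff_eq_0)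
  then show ?thesis
    unfolding hardy_extension_def fourier_coeff_poly by (simp add: sums_iff poly_altdef)
qed

lemma hardy_extension_diff:
  assumes "integrable dz f" "integrable dz g" "cmod w < 1"
  shows "hardy_extension (\<lambda>z. f z - g z) w = hardy_extension f w - hardy_extension g w"
proof -
  have "(\<lambda>k. fourier_coeff f k * w ^ k - fourier_coeff g k * w ^ k) sums (hardy_extension f w - hardy_extension g w)"
    by (intro sums_diff hardy_extension_sums assms)
  then show ?thesis
    unfolding hardy_extension_def fourier_coeff_diff[OF assms(1,2)] by (simp add: sums_iff left_diff_distrib)
qed

text \<open>Evaluation at an interior point is bounded in the \<open>L\<^sup>1\<close> norm, so \<open>L\<^sup>1\<close> convergence on the circle
  gives locally uniform convergence in the disc.\<close>

lemma norm_poly_minus_hardy_extension_le: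
  assumes f: "integrable dz f" and w: "cmod w < 1"
  shows "cmod (poly p w - hardy_extension f w) \<le> (\<integral>z. cmod (poly p z - f z) \<partial>dz) / (1 - cmod w)"
  using hardy_extension_sums(2)[OF Bochner_Integration.integrable_diff[OF integrable_dz_poly[of p] f] w]
  unfolding hardy_extension_diff[OF integrable_dz_poly f w] hardy_extension_poly[OF w] .

text \<open>The estimate for polynomials passes to the limit with \<open>r\<close> fixed; the uniform error is a multiple
  of the \<open>L\<^sup>1\<close> distance and disappears.\<close>

lemma radial_value_estimate_extension:
  assumes f: "integrable dz f" and lim: "(\<lambda>n. \<integral>z. cmod (poly (p n) z - f z) \<partial>dz) \<longlonglongrightarrow> 0"
    and z: "z \<in> circle" and r: "0 \<le> r" "r < 1" and nn: "0 \<le> \<epsilon>" "0 \<le> C" "0 \<le> K"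
    and bound: "\<And>n w. n \<ge> n0 \<Longrightarrow> w \<in> circle \<Longrightarrow>
      cmod (primitive (p n) (z * w) - primitive (p n) z - A * \<i> * of_real (Im w))
        \<le> \<epsilon> * \<bar>Im w\<bar> + K * (\<integral>z. cmod (poly (p n) z - f z) \<partial>dz) + C * cmod (w - 1) ^ 4"
  shows "cmod (z * hardy_extension f (of_real r * z) - A) \<le> \<epsilon> + C * (32 * (1 - r\<^sup>2))"
proof -
  define e where "e = (\<lambda>n. \<integral>z. cmod (poly (p n) z - f z) \<partial>dz)"
  have e0: "0 \<le> e n" for n by (simp add: e_def)
  have rz: "cmod (of_real r * z) = r" using z r by (simp add: circle_def norm_mult)
  have "(\<lambda>n. e n / (1 - r)) \<longlonglongrightarrow> 0 / (1 - r)"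
    using lim r by (intro tendsto_divide tendsto_const) (auto simp: e_def)
  then have lim0: "(\<lambda>n. e n / (1 - r)) \<longlonglongrightarrow> 0" by simp
  have le: "cmod (poly (p n) (of_real r * z) - hardy_extension f (of_real r * z)) \<le> e n / (1 - r)" for n
    using norm_poly_minus_hardy_extension_le[OF f, of "of_real r * z" "p n"] r rz by (simp add: e_def)
  have "(\<lambda>n. poly (p n) (of_real r * z) - hardy_extension f (of_real r * z)) \<longlonglongrightarrow> 0"
    by (rule Lim_null_comparison[OF _ lim0]) (use le in simp)
  then have "(\<lambda>n. poly (p n) (of_real r * z)) \<longlonglongrightarrow> hardy_extension f (of_real r * z)"
    by (rule LIM_zero_cancel)
  then have 1: "(\<lambda>n. cmod (z * poly (p n) (of_real r * z) - A)) \<longlonglongrightarrow> cmod (z * hardy_extension f (of_real r * z) - A)"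
    by (intro tendsto_intros)
  have 2: "(\<lambda>n. \<epsilon> + (K * e n) * (2 * (1 - r\<^sup>2) / (1 - r) ^ 4) + C * (32 * (1 - r\<^sup>2)))
      \<longlonglongrightarrow> \<epsilon> + (K * 0) * (2 * (1 - r\<^sup>2) / (1 - r) ^ 4) + C * (32 * (1 - r\<^sup>2))"
    using lim by (intro tendsto_intros) (simp add: e_def)
  have "cmod (z * hardy_extension f (of_real r * z) - A) \<le> \<epsilon> + (K * 0) * (2 * (1 - r\<^sup>2) / (1 - r) ^ 4) + C * (32 * (1 - r\<^sup>2))"
  proof (rule LIMSEQ_le[OF 1 2], intro exI allI impI)
    fix n assume n: "n \<ge> n0"
    have "cmod (primitive (p n) (z * w) - primitive (p n) z - A * \<i> * of_real (Im w))
        \<le> \<epsilon> * \<bar>Im w\<bar> + K * e n + C * cmod (w - 1) ^ 4" if "w \<in> circle" for w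
      using bound[OF n that] by (simp add: e_def)
    then show "cmod (z * poly (p n) (of_real r * z) - A) \<le>
        \<epsilon> + (K * e n) * (2 * (1 - r\<^sup>2) / (1 - r) ^ 4) + C * (32 * (1 - r\<^sup>2))"
      using nn e0
      by (intro radial_value_estimate[OF z r]) auto
  qed
  then show ?thesis by simp
qed

text \<open>Allows the angle and its sine to be exchanged in linear approximations at \<open>0\<close>.\<close>

lemma sin_near_zero:
  fixes \<epsilon> :: real
  assumes "\<epsilon> > 0"
  obtains d where "d > 0" "\<And>t. \<bar>t\<bar> < d \<Longrightarrow> \<bar>sin t - t\<bar> \<le> \<epsilon> * \<bar>t\<bar> \<and> \<bar>t\<bar> \<le> 2 * \<bar>sin t\<bar>"
proof -
  define \<delta> where "\<delta> = min \<epsilon> (1/2)"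
  have \<delta>: "\<delta> > 0" "\<delta> \<le> \<epsilon>" "\<delta> \<le> 1/2" using assms by (auto simp: \<delta>_def)
  have "(sin has_derivative (*) 1) (at (0::real))"
    using DERIV_sin[of "0::real"] by (simp add: has_field_derivative_def)
  then obtain d where d: "d > 0" "\<And>t. norm (t - 0) < d \<Longrightarrow> norm (sin t - sin 0 - 1 * (t - 0)) \<le> \<delta> * norm (t - (0::real))"
    unfolding has_derivative_at_alt using \<delta>(1) by blast
  show ?thesis
  proof (rule that[OF d(1)])
    fix t :: real assume "\<bar>t\<bar> < d"
    then have *: "\<bar>sin t - t\<bar> \<le> \<delta> * \<bar>t\<bar>" using d(2)[of t] by simp
    moreover have "\<delta> * \<bar>t\<bar> \<le> \<epsilon> * \<bar>t\<bar>" "\<delta> * \<bar>t\<bar> \<le> 1/2 * \<bar>t\<bar>"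
      using \<delta> by (intro mult_right_mono; simp)+
    ultimately show "\<bar>sin t - t\<bar> \<le> \<epsilon> * \<bar>t\<bar> \<and> \<bar>t\<bar> \<le> 2 * \<bar>sin t\<bar>" by linarith
  qed
qed

text \<open>Fatou's theorem. At almost every angle \<open>t\<close> the indefinite integral of \<open>g s = \<i> * cis s * f (cis s)\<close>
  is differentiable with derivative \<open>g t\<close>. The primitives of the approximating polynomials \<open>p n\<close> have increments
  \<open>\<integral> \<i> * cis s * p n (cis s)\<close>, so they differ from the increments of this indefinite
  integral by at most a multiple of the \<open>L\<^sup>1\<close> distance, uniformly in the interval. Hence they are
  approximately linear at \<open>z = cis t\<close> with slope \<open>A = z * f z\<close>, and the radial estimate gives
  \<open>z * F (r * z) \<longlonglongrightarrow> z * f z\<close>.\<close>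

theorem radial_limits_of_hardy_extension:
  assumes f: "integrable dz f" and lim: "(\<lambda>n. \<integral>z. cmod (poly (p n) z - f z) \<partial>dz) \<longlonglongrightarrow> 0"
  shows "AE z in dz. ((\<lambda>r. hardy_extension f (of_real r * z)) \<longlongrightarrow> f z) (at_left (1::real))"
proof -
  define e where "e = (\<lambda>n. \<integral>z. cmod (poly (p n) z - f z) \<partial>dz)"
  have e0: "0 \<le> e n" for n by (simp add: e_def)
  define g where "g = (\<lambda>s. if s \<in> {0..2*pi} then \<i> * cis s * f (cis s) else 0)"
  have circ_int: "set_integrable lborel {0..2*pi} (\<lambda>s. h (cis s))" if "integrable dz h" for h :: "complex \<Rightarrow> complex"
    using integrable_dz_iff[of h] that by auto
  have if_: "integrable dz (\<lambda>z. f z * (\<i> * z))"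
    by (intro integrable_dz_mult_continuous f continuous_on_mult continuous_on_const continuous_on_id)
  have g_on: "g integrable_on {0..2*pi}"
  proof -
    have "(\<lambda>s. f (cis s) * (\<i> * cis s)) integrable_on {0..2*pi}"
      by (rule set_borel_integral_eq_integral(1)[OF circ_int[OF if_]])
    then show ?thesis by (rule integrable_eq) (simp add: g_def mult_ac)
  qed
  have "g integrable_on UNIV"
  proof -
    have "(\<lambda>s. if s \<in> {0..2*pi} then g s else 0) integrable_on UNIV"
      using g_on by (simp only: integrable_restrict_UNIV)
    moreover have "(\<lambda>s. if s \<in> {0..2*pi} then g s else 0) = g" by (auto simp: g_def)
    ultimately show ?thesis by simp
  qed
  then have g_int: "g integrable_on {a..b}" for a b
    by (rule integrable_on_subinterval) simp
  have diff_int: "integrable dz (\<lambda>z. poly q z - f z)" for q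
    by (intro Bochner_Integration.integrable_diff integrable_dz_poly f)
  \<comment> \<open>stated for every polynomial, since \<open>q = 0\<close> also bounds the integrals of \<open>g\<close> themselves\<close>
  have prim_diff: "cmod (primitive q (cis b) - primitive q (cis a) - integral {a..b} g) \<le> 2 * pi * (\<integral>z. cmod (poly q z - f z) \<partial>dz)"
    if ab: "0 \<le> a" "a \<le> b" "b \<le> 2*pi" for q a b
  proof -
    define u where "u = (\<lambda>s. \<i> * cis s * poly q (cis s) - g s)"
    have u: "(u has_integral (primitive q (cis b) - primitive q (cis a) - integral {a..b} g)) {a..b}"
      unfolding u_def by (intro has_integral_diff primitive_cis_diff ab integrable_integral g_int)
    have nu: "norm (u s) = cmod (poly q (cis s) - f (cis s))" if "s \<in> {0..2*pi}" for s
    proof -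
      have "u s = (\<i> * cis s) * (poly q (cis s) - f (cis s))"
        using that by (simp add: u_def g_def algebra_simps)
      then show ?thesis by (simp add: norm_mult)
    qed
    have m: "(\<lambda>z. cmod (poly q z - f z)) \<in> borel_measurable dz"
      using diff_int[of q] by auto
    have si: "set_integrable lborel {0..2*pi} (\<lambda>s. cmod (poly q (cis s) - f (cis s)))"
      using integrable_dz_iff[OF m] integrable_norm[OF diff_int[of q]] by simp
    have I: "(\<lambda>s. cmod (poly q (cis s) - f (cis s))) integrable_on {0..2*pi}"
      by (rule set_borel_integral_eq_integral(1)[OF si])
    have I': "(\<lambda>s. cmod (poly q (cis s) - f (cis s))) integrable_on {a..b}"
      by (rule integrable_on_subinterval[OF I]) (use ab in auto)
    have "cmod (integral {a..b} u) \<le> integral {a..b} (\<lambda>s. cmod (poly q (cis s) - f (cis s)))"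
      by (rule integral_norm_bound_integral[OF has_integral_integrable[OF u] I']) (use nu ab in auto)
    also have "\<dots> \<le> integral {0..2*pi} (\<lambda>s. cmod (poly q (cis s) - f (cis s)))"
      by (rule integral_subset_le[OF _ I' I]) (use ab in auto)
    also have "\<dots> = 2 * pi * (\<integral>z. cmod (poly q z - f z) \<partial>dz)"
      unfolding integral_dz[OF m] set_borel_integral_eq_integral(2)[OF si] by simp
    finally show ?thesis using u by (simp add: integral_unique)
  qed
  have pd: "cmod (primitive (p n) (cis b) - primitive (p n) (cis a) - integral {a..b} g) \<le> 2 * pi * e n"
    if "0 \<le> a" "a \<le> b" "b \<le> 2*pi" for n a b
    using prim_diff[OF that, of "p n"] by (simp add: e_def)
  obtain N where N: "negligible N" and leb: "\<And>x e. x \<notin> N \<Longrightarrow> 0 < e \<Longrightarrow> \<exists>d>0. \<forall>h. 0 \<le> h \<and> h < d \<longrightarrow>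
       norm (integral {x..x + h} g - h *\<^sub>R g x) \<le> e * h \<and>
       norm (integral {x - h..x} g - h *\<^sub>R g x) \<le> e * h"
    using lebesgue_two_sided_point[OF g_int] by blast
  show ?thesis
  proof (rule AE_dz_from_angle[OF N])
    fix t assume t: "0 < t" "t < 2 * pi" "t \<notin> N"
    define z where "z = cis t"
    have z: "z \<in> circle" by (simp add: z_def)
    define A where "A = z * f z"
    have gt: "g t = \<i> * A" using t by (simp add: g_def A_def z_def)
    define B where "B = 2 * pi * (\<integral>z. cmod (f z) \<partial>dz)"
    have B: "cmod (integral {a..b} g) \<le> B" if "0 \<le> a" "a \<le> b" "b \<le> 2*pi" for a b
      using prim_diff[OF that, of 0] by (simp add: primitive_def B_def)
    have "((\<lambda>r. z * hardy_extension f (of_real r * z)) \<longlongrightarrow> A) (at_left 1)"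
    proof (rule tendstoI)
      fix \<epsilon>0 :: real assume \<epsilon>0: "\<epsilon>0 > 0"
      \<comment> \<open>replacing \<open>s\<close> by \<open>sin s\<close> costs a factor \<open>2\<close> and an error \<open>\<epsilon> * cmod A\<close>; the other half of \<open>\<epsilon>0\<close> is left for the multiple of \<open>1 - r\<^sup>2\<close>\<close>
      define \<epsilon> where "\<epsilon> = \<epsilon>0 / (4 * (1 + cmod A))"
      have Apos: "1 + cmod A > 0" by (intro add_pos_nonneg) auto
      have \<epsilon>: "\<epsilon> > 0" "2 * (\<epsilon> * (1 + cmod A)) = \<epsilon>0 / 2"
        using \<epsilon>0 Apos by (auto simp: \<epsilon>_def field_simps)
      obtain d1 where d1: "d1 > 0" "\<And>h. 0 \<le> h \<Longrightarrow> h < d1 \<Longrightarrow>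
          norm (integral {t..t + h} g - h *\<^sub>R g t) \<le> \<epsilon> * h \<and>
          norm (integral {t - h..t} g - h *\<^sub>R g t) \<le> \<epsilon> * h"
        using leb[OF t(3) \<epsilon>(1)] by blast
      obtain d2 where d2: "d2 > 0" "\<And>t. \<bar>t\<bar> < d2 \<Longrightarrow> \<bar>sin t - t\<bar> \<le> \<epsilon> * \<bar>t\<bar> \<and> \<bar>t\<bar> \<le> 2 * \<bar>sin t\<bar>"
        using sin_near_zero[OF \<epsilon>(1)] by blast
      define d where "d = min (min d1 d2) (min t (2 * pi - t))"
      have d: "d > 0" using d1 d2 t by (simp add: d_def)
      have near: "cmod (primitive (p n) (z * cis s) - primitive (p n) z - A * \<i> * of_real (sin s)) \<le>
          \<epsilon>0 / 2 * \<bar>sin s\<bar> + 2 * pi * e n" if s: "\<bar>s\<bar> < d" for s n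
      proof -
        have s': "0 < t + s" "t + s < 2 * pi" "\<bar>s\<bar> < d1" "\<bar>s\<bar> < d2" using s by (auto simp: d_def)
        have zs: "z * cis s = cis (t + s)" by (simp add: z_def cis_mult)
        have n1: "cmod (primitive (p n) (cis (t + s)) - primitive (p n) (cis t) - s *\<^sub>R g t) \<le> \<epsilon> * \<bar>s\<bar> + 2 * pi * e n"
        proof (cases "s \<ge> 0")
          case True
          have "primitive (p n) (cis (t + s)) - primitive (p n) (cis t) - s *\<^sub>R g t =
            (primitive (p n) (cis (t + s)) - primitive (p n) (cis t) - integral {t..t + s} g) + (integral {t..t + s} g - s *\<^sub>R g t)"
            by simp
          also have "cmod \<dots> \<le> 2 * pi * e n + \<epsilon> * s"
            by (rule order_trans[OF norm_triangle_ineq add_mono])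
               (use True s' t d1(2)[of s] in \<open>auto intro!: pd\<close>)
          finally show ?thesis using True by simp
        next
          case False
          have "primitive (p n) (cis (t + s)) - primitive (p n) (cis t) - s *\<^sub>R g t =
            - ((primitive (p n) (cis t) - primitive (p n) (cis (t + s)) - integral {t + s..t} g) + (integral {t - (- s)..t} g - (- s) *\<^sub>R g t))"
            by simp
          also have "cmod \<dots> \<le> 2 * pi * e n + \<epsilon> * (- s)"
            unfolding norm_minus_cancel
            by (rule order_trans[OF norm_triangle_ineq add_mono])
               (use False s' t d1(2)[of "- s"] in \<open>auto intro!: pd\<close>)
          finally show ?thesis using False by simp
        qed
        have n2: "cmod (s *\<^sub>R g t - A * \<i> * of_real (sin s)) \<le> cmod A * (\<epsilon> * \<bar>s\<bar>)"
        proof -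
          have "s *\<^sub>R g t - A * \<i> * of_real (sin s) = (A * \<i>) * of_real (s - sin s)"
            by (simp add: gt scaleR_conv_of_real algebra_simps)
          then have "cmod (s *\<^sub>R g t - A * \<i> * of_real (sin s)) = cmod A * \<bar>s - sin s\<bar>"
            by (simp only: norm_mult norm_of_real) simp
          moreover have "\<bar>s - sin s\<bar> \<le> \<epsilon> * \<bar>s\<bar>" using d2(2)[OF s'(4)] by (simp add: abs_minus_commute)
          ultimately show ?thesis by (simp add: mult_left_mono)
        qed
        have split: "(x - y - v) + (v - u) = x - y - u" for x y v u :: complex by simp
        have "cmod (primitive (p n) (z * cis s) - primitive (p n) z - A * \<i> * of_real (sin s)) \<le>
          \<epsilon> * \<bar>s\<bar> + 2 * pi * e n + cmod A * (\<epsilon> * \<bar>s\<bar>)"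
          using norm_triangle_mono[OF n1 n2] unfolding zs split by (simp only: z_def)
        also have "\<dots> = (\<epsilon> * (1 + cmod A)) * \<bar>s\<bar> + 2 * pi * e n" by (simp add: algebra_simps)
        also have "\<dots> \<le> (\<epsilon> * (1 + cmod A)) * (2 * \<bar>sin s\<bar>) + 2 * pi * e n"
          using d2(2)[OF s'(4)] \<epsilon>(1) Apos by (intro add_right_mono mult_left_mono) auto
        also have "\<dots> = \<epsilon>0 / 2 * \<bar>sin s\<bar> + 2 * pi * e n" unfolding \<epsilon>(2)[symmetric] by simp
        finally show ?thesis .
      qed
      have "isCont Arg 1" by (rule continuous_at_Arg) simp
      then obtain \<delta> where \<delta>: "\<delta> > 0" "\<And>w. cmod (w - 1) < \<delta> \<Longrightarrow> \<bar>Arg w\<bar> < d"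
        using d unfolding continuous_at_eps_delta dist_norm by (metis Arg_1 diff_zero real_norm_def)
      \<comment> \<open>outside the \<open>\<delta>\<close>-neighbourhood of \<open>1\<close> the quartic term alone dominates the deviation\<close>
      define C where "C = (2 * pi + B + cmod A) / \<delta> ^ 4"
      have "B \<ge> 0" by (simp add: B_def)
      then have C: "C \<ge> 0" using \<delta> by (simp add: C_def)
      obtain n0 where n0: "\<And>n. n \<ge> n0 \<Longrightarrow> e n \<le> 1"
        using LIMSEQ_D[OF lim, of 1] unfolding e_def by fastforce
      have far: "cmod (primitive (p n) (z * w) - primitive (p n) z - A * \<i> * of_real (Im w)) \<le> 2 * pi + B + cmod A"
        if w: "w \<in> circle" and n: "n \<ge> n0" for w n
      proof -
        define b where "b = Arg2pi (z * w)"
        have b: "0 \<le> b" "b \<le> 2 * pi" "z * w = cis b"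
          using Arg2pi_ge_0[of "z * w"] Arg2pi_lt_2pi[of "z * w"] cis_Arg2pi_circle[of "z * w"] w z
          by (auto simp: b_def circle_def norm_mult)
        have en: "2 * pi * e n \<le> 2 * pi" using n0[OF n] by (simp add: mult_left_le)
        have aux: "cmod (x - y) \<le> 2 * pi + B" if "cmod (x - y - integral {a..b} g) \<le> 2 * pi * e n" "0 \<le> a" "a \<le> b" "b \<le> 2*pi" for x y a b
        proof -
          have "cmod (x - y) \<le> cmod (x - y - integral {a..b} g) + cmod (integral {a..b} g)"
            using norm_triangle_ineq[of "x - y - integral {a..b} g" "integral {a..b} g"] by simp
          then show ?thesis using B[of a b] that en by linarith
        qed
        have "cmod (primitive (p n) (z * w) - primitive (p n) z) \<le> 2 * pi + B"
        proof (cases "t \<le> b")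
          case True
          then show ?thesis unfolding b(3) unfolding z_def using t b by (intro aux[OF pd]) auto
        next
          case False
          then show ?thesis unfolding b(3) unfolding z_def norm_minus_commute[of "primitive (p n) (cis b)"]
            using t b by (intro aux[OF pd]) auto
        qed
        moreover have "cmod (A * \<i> * of_real (Im w)) \<le> cmod A"
          using abs_Im_le_cmod[of w] w by (simp add: norm_mult circle_def mult_left_le)
        ultimately show ?thesis
          using norm_triangle_ineq4[of "primitive (p n) (z * w) - primitive (p n) z" "A * \<i> * of_real (Im w)"] by linarith
      qed
      have est: "cmod (z * hardy_extension f (of_real r * z) - A) \<le> \<epsilon>0 / 2 + C * (32 * (1 - r\<^sup>2))"
        if r: "0 \<le> r" "r < 1" for r
      proof (rule radial_value_estimate_extension[OF f lim z r, where K = "2 * pi" and ?n0.0 = n0])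
        fix n w assume n: "n \<ge> n0" and w: "w \<in> circle"
        show "cmod (primitive (p n) (z * w) - primitive (p n) z - A * \<i> * of_real (Im w))
          \<le> \<epsilon>0 / 2 * \<bar>Im w\<bar> + 2 * pi * (\<integral>z. cmod (poly (p n) z - f z) \<partial>dz) + C * cmod (w - 1) ^ 4"
        proof (cases "cmod (w - 1) < \<delta>")
          case True
          have "w \<noteq> 0" "cmod w = 1" using w by (auto simp: circle_def)
          then have "w = cis (Arg w)" using cis_Arg[of w] by (simp add: sgn_div_norm)
          then obtain s where s: "w = cis s" "\<bar>s\<bar> < d" using \<delta>(2)[OF True] by metis
          have "0 \<le> C * cmod (w - 1) ^ 4" using C by simp
          then show ?thesis using near[OF s(2), of n] unfolding e_def s(1) by simp
        next
          case False
          have "\<delta> ^ 4 \<le> cmod (w - 1) ^ 4" using False \<delta> by (intro power_mono) auto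
          then have "C * \<delta> ^ 4 \<le> C * cmod (w - 1) ^ 4" using C by (intro mult_left_mono)
          moreover have "C * \<delta> ^ 4 = 2 * pi + B + cmod A" using \<delta> by (simp add: C_def)
          moreover have "0 \<le> \<epsilon>0 / 2 * \<bar>Im w\<bar> + 2 * pi * e n" using \<epsilon>0 e0[of n] by simp
          ultimately show ?thesis using far[OF w n] unfolding e_def by linarith
        qed
      qed (use \<epsilon>0 C in auto)
      have "((\<lambda>r. \<epsilon>0 / 2 + C * (32 * (1 - r\<^sup>2))) \<longlongrightarrow> \<epsilon>0 / 2 + C * (32 * (1 - 1\<^sup>2))) (at_left (1::real))"
        by (intro tendsto_intros)
      then have "\<forall>\<^sub>F r in at_left 1. \<epsilon>0 / 2 + C * (32 * (1 - r\<^sup>2)) < \<epsilon>0"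
        by (rule order_tendstoD(2)) (use \<epsilon>0 in simp)
      moreover have "\<forall>\<^sub>F r in at_left (1::real). 0 < r \<and> r < 1"
        using eventually_at_left_real[of 0 "1::real"] by simp
      ultimately show "\<forall>\<^sub>F r in at_left 1. dist (z * hardy_extension f (of_real r * z)) A < \<epsilon>0"
      proof eventually_elim
        case (elim r)
        then show ?case using est[of r] by (simp add: dist_norm)
      qed
    qed
    then have "((\<lambda>r. cnj z * (z * hardy_extension f (of_real r * z))) \<longlongrightarrow> cnj z * A) (at_left 1)"
      by (rule tendsto_mult_left)
    moreover have "cnj z * (z * v) = v" for v
    proof -
      have "cnj z * z = 1" using z by (simp add: circle_def complex_norm_square[symmetric] mult.commute)
      then show ?thesis by (simp add: mult.assoc[symmetric])
    qed
    ultimately show "((\<lambda>r. hardy_extension f (of_real r * cis t)) \<longlongrightarrow> f (cis t)) (at_left 1)"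
      by (simp add: A_def z_def)
  qed
qed

section \<open>Dilations of polynomials\<close>

text \<open>Dualize: with \<open>u\<close> the conjugate sign of \<open>p (r * z)\<close>, the function \<open>h w = \<integral> u z * p (w * z)\<close> is a
  polynomial in \<open>w\<close> whose value at \<open>r\<close> is the left-hand side, while on the circle it is bounded by the
  right-hand side, by rotation invariance. The maximum principle compares the two.\<close>

lemma integral_norm_poly_dilation_le:
  assumes r: "0 \<le> r" "r < 1"
  shows "(\<integral>z. cmod (poly p (of_real r * z)) \<partial>dz) \<le> (\<integral>z. cmod (poly p z) \<partial>dz)"
proof -
  define u where "u = (\<lambda>z. cnj (poly p (of_real r * z)) / of_real (cmod (poly p (of_real r * z))))"
  have cr: "continuous_on circle (\<lambda>z. poly p (of_real w * z))" for w :: real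
    by (intro continuous_intros)
  have um: "u \<in> borel_measurable dz"
    unfolding u_def
    by (intro borel_measurable_divide borel_measurable_dz_continuous continuous_on_cnj continuous_on_of_real
        continuous_on_norm cr)
  have u1: "cmod (u z) \<le> 1" for z by (simp add: u_def norm_divide)
  have ui: "integrable dz u"
    by (rule finite_measure.integrable_const_bound[OF prob_space.axioms(1)[OF prob_space_dz] _ um, of 1])
       (use u1 in auto)
  define c where "c = (\<lambda>n. \<integral>z. u z * z ^ n \<partial>dz)"
  define h where "h = (\<lambda>w. \<Sum>n\<le>degree p. coeff p n * c n * w ^ n)"
  have iuz: "integrable dz (\<lambda>z. u z * z ^ n)" for n
    by (intro integrable_dz_mult_continuous ui continuous_on_power continuous_on_id)
  have h: "h w = (\<integral>z. u z * poly p (w * z) \<partial>dz)" for w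
  proof -
    have "(\<integral>z. u z * poly p (w * z) \<partial>dz) = (\<integral>z. (\<Sum>n\<le>degree p. coeff p n * w ^ n * (u z * z ^ n)) \<partial>dz)"
      unfolding poly_altdef sum_distrib_left
      by (intro Bochner_Integration.integral_cong sum.cong refl) (simp add: power_mult_distrib)
    also have "\<dots> = (\<Sum>n\<le>degree p. coeff p n * w ^ n * c n)"
      unfolding c_def integral_mult_right_zero[symmetric]
      by (rule Bochner_Integration.integral_sum) (intro integrable_mult_right iuz)
    finally show ?thesis by (simp add: h_def mult_ac)
  qed
  have hol: "h holomorphic_on A" for A
    unfolding h_def by (intro holomorphic_intros)
  have edge: "cmod (h w) \<le> (\<integral>z. cmod (poly p z) \<partial>dz)" if w: "w \<in> circle" for w
  proof -
    have cw: "continuous_on circle (\<lambda>z. poly p (w * z))" by (intro continuous_intros)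
    have "cmod (h w) \<le> (\<integral>z. cmod (u z * poly p (w * z)) \<partial>dz)"
      unfolding h by (rule integral_norm_bound)
    also have "\<dots> \<le> (\<integral>z. cmod (poly p (w * z)) \<partial>dz)"
    proof (rule integral_mono)
      show "integrable dz (\<lambda>z. cmod (u z * poly p (w * z)))"
        by (rule integrable_norm[OF integrable_dz_mult_continuous[OF ui cw]])
      show "integrable dz (\<lambda>z. cmod (poly p (w * z)))"
        by (rule integrable_norm[OF integrable_dz_continuous[OF cw]])
      show "cmod (u z * poly p (w * z)) \<le> cmod (poly p (w * z))" for z
        unfolding norm_mult by (rule mult_left_le_one_le) (use u1 in auto)
    qed
    also have "\<dots> = (\<integral>z. cmod (poly p z) \<partial>dz)"
      by (rule integral_dz_rotate[OF continuous_on_norm[OF continuous_on_poly_complex] w])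
    finally show ?thesis .
  qed
  have eq: "u z * poly p (of_real r * z) = of_real (cmod (poly p (of_real r * z)))" for z
  proof (cases "poly p (of_real r * z) = 0")
    case False
    have "cnj v / of_real (cmod v) * v = of_real (cmod v)" if "v \<noteq> 0" for v
    proof -
      have "cnj v * v = of_real (cmod v) * of_real (cmod v)"
        by (metis complex_norm_square mult.commute of_real_power power2_eq_square)
      then show ?thesis using that by (simp add: field_simps)
    qed
    with False show ?thesis unfolding u_def by blast
  qed simp
  have "(\<integral>z. cmod (poly p (of_real r * z)) \<partial>dz) = cmod (h (of_real r))"
    unfolding h eq integral_complex_of_real norm_of_real by simp
  also have "\<dots> \<le> (\<integral>z. cmod (poly p z) \<partial>dz)"
    by (rule maximum_modulus_frontier[of h "cball 0 1"])
       (use r edge hol in \<open>auto simp: circle_def intro: holomorphic_on_imp_continuous_on\<close>)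
  finally show ?thesis .
qed

section \<open>Jensen's inequality and the integrability of the logarithm\<close>

text \<open>The mean value property: by orthogonality to constants, only the constant term survives termwise
  integration.\<close>

lemma integral_power_series_dz:
  assumes a: "summable (\<lambda>n. cmod (a n))" and s: "\<And>z. z \<in> circle \<Longrightarrow> (\<lambda>n. a n * z ^ n) sums f z"
  shows "(\<integral>z. f z \<partial>dz) = a 0"
proof -
  interpret prob_space dz by (rule prob_space_dz)
  have int: "integrable dz (\<lambda>z. a n * z ^ n)" for n
    by (intro integrable_dz_continuous continuous_on_mult continuous_on_const continuous_on_power continuous_on_id)
  have n: "cmod (a n * z ^ n) = cmod (a n)" if "z \<in> circle" for z n
    using that by (simp add: circle_def norm_mult norm_power)
  have "(\<lambda>n. \<integral>z. a n * z ^ n \<partial>dz) sums (\<integral>z. (\<Sum>n. a n * z ^ n) \<partial>dz)"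
  proof (rule sums_integral[OF int])
    show "AE z in dz. summable (\<lambda>n. norm (a n * z ^ n))"
      by (rule AE_I2) (use n a in simp)
    have "(\<integral>z. norm (a n * z ^ n) \<partial>dz) = (\<integral>z. cmod (a n) \<partial>dz)" for n
      by (rule Bochner_Integration.integral_cong[OF refl n]) simp
    moreover have "(\<integral>z. cmod (a n) \<partial>dz) = cmod (a n)" for n
      using prob_space by (simp del: space_dz)
    ultimately show "summable (\<lambda>n. \<integral>z. norm (a n * z ^ n) \<partial>dz)" using a by simp
  qed
  moreover have "(\<integral>z. (\<Sum>n. a n * z ^ n) \<partial>dz) = (\<integral>z. f z \<partial>dz)"
    by (intro Bochner_Integration.integral_cong refl) (use s in \<open>simp add: sums_iff\<close>)
  moreover have "(\<integral>z. a n * z ^ n \<partial>dz) = (if n = 0 then a 0 else 0)" for n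
    unfolding integral_mult_right_zero integral_dz_power by simp
  moreover have "(\<lambda>n. if n = 0 then a 0 else 0) sums a 0"
    using sums_single[of 0 "\<lambda>_. a 0"] by simp
  ultimately show ?thesis by (simp add: sums_iff)
qed

lemma integral_ln_norm_one_minus:
  assumes b: "cmod b < 1"
  shows "(\<integral>z. ln (cmod (1 - b * z)) \<partial>dz) = 0"
proof -
  define a where "a = (\<lambda>n. - (b ^ n) / of_nat n :: complex)"
  have bz: "cmod (- (b * z)) < 1" if "z \<in> circle" for z
    using that b by (simp add: circle_def norm_mult)
  have s: "(\<lambda>n. a n * z ^ n) sums Ln (1 - b * z)" if "z \<in> circle" for z
    using Ln_series'[OF bz[OF that]] by (simp add: a_def power_mult_distrib)
  have "summable (\<lambda>n. cmod (a n))"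
  proof (rule summable_comparison_test'[OF summable_geometric[of "cmod b"]])
    fix n :: nat
    show "norm (cmod (a n)) \<le> cmod b ^ n"
    proof (cases "n = 0")
      case False
      then have "cmod b ^ n / real n \<le> cmod b ^ n / 1" by (intro divide_left_mono) auto
      then show ?thesis by (simp add: a_def norm_divide norm_power)
    qed (simp add: a_def)
  qed (use b in simp)
  from integral_power_series_dz[OF this s] have I: "(\<integral>z. Ln (1 - b * z) \<partial>dz) = 0" by (simp add: a_def)
  have nz: "1 - b * z \<noteq> 0" if "z \<in> circle" for z using bz[OF that] by auto
  have pos: "1 - b * z \<notin> \<real>\<^sub>\<le>\<^sub>0" if "z \<in> circle" for z
  proof -
    have "Re (b * z) < 1" using bz[OF that] complex_Re_le_cmod[of "b * z"] by simp
    then show ?thesis by (simp add: complex_nonpos_Reals_iff)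
  qed
  have int: "integrable dz (\<lambda>z. Ln (1 - b * z))"
    by (intro integrable_dz_continuous continuous_on_Ln' continuous_intros) (use pos in auto)
  have "(\<integral>z. ln (cmod (1 - b * z)) \<partial>dz) = (\<integral>z. Re (Ln (1 - b * z)) \<partial>dz)"
    by (intro Bochner_Integration.integral_cong refl) (use nz in simp)
  then show ?thesis by (simp add: integral_Re[OF int] I)
qed

text \<open>The integral is \<open>ln (max 1 (cmod a))\<close>: for \<open>\<bar>a\<bar> < 1\<close> the factor \<open>z - a\<close> may be replaced on the
  circle by its reflection \<open>1 - cnj a * z\<close>, which has no zero in the disc.\<close>

lemma ln_norm_le_integral_ln_norm_linear:
  assumes a: "a \<noteq> 0" "cmod a \<noteq> 1"
  shows "ln (cmod a) \<le> (\<integral>z. ln (cmod (z - a)) \<partial>dz)"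
proof (cases "cmod a < 1")
  case True
  have "(\<integral>z. ln (cmod (z - a)) \<partial>dz) = (\<integral>z. ln (cmod (1 - cnj a * z)) \<partial>dz)"
  proof (rule Bochner_Integration.integral_cong[OF refl])
    fix z assume "z \<in> space dz"
    then have z: "cmod z = 1" by (simp add: circle_def)
    then have "z * cnj z = 1" by (simp add: complex_norm_square[symmetric])
    then have "z * cnj (z - a) = 1 - cnj a * z" by (simp add: algebra_simps)
    then have "cmod (1 - cnj a * z) = cmod (z * cnj (z - a))" by simp
    also have "\<dots> = cmod (z - a)" unfolding norm_mult complex_mod_cnj using z by simp
    finally show "ln (cmod (z - a)) = ln (cmod (1 - cnj a * z))" by simp
  qed
  also have "\<dots> = 0" by (rule integral_ln_norm_one_minus) (use True in simp)
  finally show ?thesis using True a by simp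
next
  case False
  then have a1: "cmod (1 / a) < 1" using a by (simp add: norm_divide)
  have i: "integrable dz (\<lambda>z. ln (cmod (1 - 1 / a * z)))"
  proof (intro integrable_dz_continuous continuous_on_ln continuous_intros ballI)
    fix z assume "z \<in> circle"
    then have "cmod (1 / a * z) < 1" using a1 by (simp add: circle_def norm_mult norm_divide)
    then show "cmod (1 - 1 / a * z) \<noteq> 0" by auto
  qed
  have "(\<integral>z. ln (cmod (z - a)) \<partial>dz) = (\<integral>z. ln (cmod a) + ln (cmod (1 - 1 / a * z)) \<partial>dz)"
  proof (rule Bochner_Integration.integral_cong[OF refl])
    fix z assume "z \<in> space dz"
    then have z: "cmod z = 1" by (simp add: circle_def)
    then have ne: "1 - 1 / a * z \<noteq> 0" using a False by auto
    have "z - a = - a * (1 - 1 / a * z)" using a by (simp add: field_simps)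
    then have "cmod (z - a) = cmod a * cmod (1 - 1 / a * z)" by (simp only: norm_mult norm_minus_cancel)
    then show "ln (cmod (z - a)) = ln (cmod a) + ln (cmod (1 - 1 / a * z))"
      using a ne by (simp add: ln_mult_pos)
  qed
  also have "\<dots> = ln (cmod a) + 0"
  proof -
    interpret prob_space dz by (rule prob_space_dz)
    show ?thesis using i integral_ln_norm_one_minus[OF a1] prob_space by (simp del: space_dz)
  qed
  finally show ?thesis by simp
qed

lemma continuous_on_ln_norm_poly:
  assumes "\<And>z. z \<in> circle \<Longrightarrow> poly p z \<noteq> 0"
  shows "continuous_on circle (\<lambda>z. ln (cmod (poly p z)))"
  by (intro continuous_on_ln continuous_on_norm continuous_on_poly_complex ballI) (use assms in simp)

text \<open>Jensen's inequality, by splitting off one linear factor at a time.\<close>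

lemma ln_norm_poly_0_le_integral:
  assumes "\<And>z. z \<in> circle \<Longrightarrow> poly p z \<noteq> 0" "poly p 0 \<noteq> 0"
  shows "ln (cmod (poly p 0)) \<le> (\<integral>z. ln (cmod (poly p z)) \<partial>dz)"
  using assms
proof (induction "degree p" arbitrary: p)
  case 0
  then obtain c where "p = [:c:]" by (metis degree_eq_zeroE)
  then show ?case using prob_space.prob_space[OF prob_space_dz] by (simp del: space_dz)
next
  case (Suc n)
  then obtain a where "poly p a = 0"
    using Fundamental_Theorem_Algebra.fundamental_theorem_of_algebra[of p] constant_degree[of p] by auto
  then obtain q where p: "p = [:- a, 1:] * q" by (metis dvdE poly_eq_0_iff_dvd)
  have pz: "poly p z = (z - a) * poly q z" for z by (simp add: p algebra_simps)
  have q0: "q \<noteq> 0" using Suc.hyps(2) p by auto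
  have dq: "n = degree q" using Suc.hyps(2) q0 unfolding p by (subst (asm) degree_mult_eq) auto
  have qz: "poly q z \<noteq> 0" "z \<noteq> a" if "z \<in> circle" for z using Suc.prems(1)[OF that] by (auto simp: pz)
  have a: "a \<noteq> 0" "poly q 0 \<noteq> 0" using Suc.prems(2) by (auto simp: pz)
  have a1: "cmod a \<noteq> 1" using qz(2)[of a] by (auto simp: circle_def)
  have ia: "integrable dz (\<lambda>z. ln (cmod (z - a)))"
    using integrable_dz_continuous[OF continuous_on_ln_norm_poly[of "[:- a, 1:]"]] qz(2) by simp
  have iq: "integrable dz (\<lambda>z. ln (cmod (poly q z)))"
    by (rule integrable_dz_continuous[OF continuous_on_ln_norm_poly]) (rule qz)
  have "ln (cmod (poly p 0)) = ln (cmod a) + ln (cmod (poly q 0))"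
    using a by (simp add: pz norm_mult ln_mult_pos)
  also have "\<dots> \<le> (\<integral>z. ln (cmod (z - a)) \<partial>dz) + (\<integral>z. ln (cmod (poly q z)) \<partial>dz)"
    by (intro add_mono ln_norm_le_integral_ln_norm_linear a a1 Suc.hyps(1)[OF dq] qz)
  also have "\<dots> = (\<integral>z. ln (cmod (z - a)) + ln (cmod (poly q z)) \<partial>dz)"
    using ia iq by simp
  also have "\<dots> = (\<integral>z. ln (cmod (poly p z)) \<partial>dz)"
    by (intro Bochner_Integration.integral_cong refl) (use qz in \<open>simp add: pz norm_mult ln_mult_pos\<close>)
  finally show ?case .
qed

text \<open>Jensen's inequality above excludes zeros on the circle. Dilating by \<open>r\<close> close to \<open>1\<close> moves the
  polynomial little, keeps its value at \<open>0\<close>, and avoids such zeros for all but finitely many \<open>r\<close>.\<close>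

lemma exists_zero_free_dilation:
  assumes p: "p \<noteq> 0" and \<epsilon>: "\<epsilon> > 0"
  obtains q where "poly q 0 = poly p 0" "\<And>z. z \<in> circle \<Longrightarrow> poly q z \<noteq> 0"
    "\<And>z. z \<in> circle \<Longrightarrow> cmod (poly q z - poly p z) < \<epsilon>"
proof -
  have "uniformly_continuous_on (cball 0 1) (poly p)"
    by (intro compact_uniformly_continuous continuous_on_poly_complex) simp
  then obtain \<delta> where \<delta>: "\<delta> > 0" "\<And>x y. x \<in> cball 0 1 \<Longrightarrow> y \<in> cball 0 1 \<Longrightarrow> dist x y < \<delta> \<Longrightarrow> dist (poly p x) (poly p y) < \<epsilon>"
    unfolding uniformly_continuous_on_def using \<epsilon> by (metis dist_commute)
  have "finite (cmod ` {x. poly p x = 0})" by (intro finite_imageI poly_roots_finite p)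
  moreover have "infinite {max 0 (1 - \<delta>)<..<(1::real)}" using \<delta>(1) by (intro infinite_Ioo) simp
  ultimately obtain r where r: "max 0 (1 - \<delta>) < r" "r < 1" "r \<notin> cmod ` {x. poly p x = 0}"
    by (metis (no_types, lifting) finite_subset greaterThanLessThan_iff subsetI)
  show ?thesis
  proof (rule that[of "pcompose p [:0, of_real r:]"])
    fix z assume z: "z \<in> circle"
    have zr: "poly (pcompose p [:0, of_real r:]) z = poly p (of_real r * z)" by (simp add: poly_pcompose mult.commute)
    have n: "cmod z = 1" "cmod (of_real r * z) = r" using z r by (simp_all add: circle_def norm_mult)
    show "poly (pcompose p [:0, of_real r:]) z \<noteq> 0"
      unfolding zr using r(3) n(2) by (metis (mono_tags, lifting) image_eqI mem_Collect_eq)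
    have "of_real r * z - z = of_real (r - 1) * z" by (simp add: algebra_simps)
    then have "dist (of_real r * z) z = \<bar>r - 1\<bar> * cmod z"
      by (simp only: dist_norm norm_mult norm_of_real)
    then have "dist (of_real r * z) z < \<delta>" using r n by simp
    then show "cmod (poly (pcompose p [:0, of_real r:]) z - poly p z) < \<epsilon>"
      unfolding zr dist_norm[symmetric] using \<delta>(2)[of "of_real r * z" z] n r by simp
  qed (simp add: poly_pcompose)
qed

text \<open>The negative part of \<open>log \<bar>w\<bar>\<close> with the value \<open>\<top>\<close> at \<open>0\<close>; only with this value, and not with
  \<open>ln 0 = 0\<close>, is it continuous, so that an integral bound excludes zeros.\<close>

definition neg_ln_norm :: "complex \<Rightarrow> ennreal" where
  "neg_ln_norm w = (if w = 0 then \<top> else ennreal (- ln (cmod w)))"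

lemma measurable_neg_ln_norm [measurable]: "neg_ln_norm \<in> borel_measurable borel"
  unfolding neg_ln_norm_def[abs_def] by measurable

lemma tendsto_neg_ln_norm: "(neg_ln_norm \<longlongrightarrow> neg_ln_norm a) (at a)"
proof (cases "a = 0")
  case True
  have "filterlim (\<lambda>w::complex. cmod w) (at_right 0) (at 0)"
    unfolding filterlim_at by (auto intro!: tendsto_norm_zero simp: eventually_at_filter)
  then have "LIM w at (0::complex). ln (cmod w) :> at_bot"
    by (rule filterlim_compose[OF ln_at_0])
  then have "LIM w at (0::complex). - ln (cmod w) :> at_top"
    by (simp add: filterlim_uminus_at_bot)
  then have "((\<lambda>w::complex. ennreal (- ln (cmod w))) \<longlongrightarrow> \<top>) (at 0)"
    by (simp only: ennreal_tendsto_top_eq_at_top)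
  then have "(neg_ln_norm \<longlongrightarrow> \<top>) (at 0)"
    by (rule Lim_transform_eventually) (auto simp: neg_ln_norm_def eventually_at_filter)
  then show ?thesis using True by (simp add: neg_ln_norm_def)
next
  case False
  have "((\<lambda>w. ennreal (- ln (cmod w))) \<longlongrightarrow> ennreal (- ln (cmod a))) (at a)"
    using False by (intro tendsto_intros) auto
  moreover have "\<forall>\<^sub>F w in at a. ennreal (- ln (cmod w)) = neg_ln_norm w"
    using tendsto_imp_eventually_ne[OF tendsto_ident_at False]
    by (auto elim!: eventually_mono simp: neg_ln_norm_def)
  ultimately have "(neg_ln_norm \<longlongrightarrow> ennreal (- ln (cmod a))) (at a)"
    by (rule Lim_transform_eventually)
  then show ?thesis using False by (simp add: neg_ln_norm_def)
qed

text \<open>From the splitting of \<open>ln\<close> into its positive part minus its negative part, the bound of the positive part of \<open>ln x\<close> by \<open>x\<close> and Jensen's inequality.\<close>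

lemma nn_integral_neg_ln_norm_poly_le:
  assumes q: "\<And>z. z \<in> circle \<Longrightarrow> poly q z \<noteq> 0" and b: "0 < b" "b \<le> cmod (poly q 0)"
  shows "(\<integral>\<^sup>+z. neg_ln_norm (poly q z) \<partial>dz) \<le> ennreal ((\<integral>z. cmod (poly q z) \<partial>dz) - ln b)"
proof -
  have i1: "integrable dz (\<lambda>z. cmod (poly q z))" using integrable_dz_norm_poly_power[of q 1] by simp
  have i2: "integrable dz (\<lambda>z. ln (cmod (poly q z)))"
    by (rule integrable_dz_continuous[OF continuous_on_ln_norm_poly[OF q]])
  have nn: "0 \<le> cmod w - ln (cmod w)" for w
  proof (cases "w = 0")
    case False
    then show ?thesis using ln_le_minus_one[of "cmod w"] by simp
  qed simp
  have "(\<integral>\<^sup>+z. neg_ln_norm (poly q z) \<partial>dz) \<le> (\<integral>\<^sup>+z. ennreal (cmod (poly q z) - ln (cmod (poly q z))) \<partial>dz)"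
    by (intro nn_integral_mono) (use q in \<open>auto simp: neg_ln_norm_def intro!: ennreal_leI\<close>)
  also have "\<dots> = ennreal (\<integral>z. cmod (poly q z) - ln (cmod (poly q z)) \<partial>dz)"
    by (rule nn_integral_eq_integral) (use i1 i2 nn in auto)
  also have "(\<integral>z. cmod (poly q z) - ln (cmod (poly q z)) \<partial>dz) =
      (\<integral>z. cmod (poly q z) \<partial>dz) - (\<integral>z. ln (cmod (poly q z)) \<partial>dz)"
    using i1 i2 by simp
  also have "ennreal \<dots> \<le> ennreal ((\<integral>z. cmod (poly q z) \<partial>dz) - ln b)"
  proof (intro ennreal_leI diff_left_mono)
    have "ln b \<le> ln (cmod (poly q 0))" using b by (subst ln_le_cancel_iff) auto
    also have "\<dots> \<le> (\<integral>z. ln (cmod (poly q z)) \<partial>dz)"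
      by (rule ln_norm_poly_0_le_integral) (use q b in auto)
    finally show "ln b \<le> (\<integral>z. ln (cmod (poly q z)) \<partial>dz)" .
  qed
  finally show ?thesis .
qed

text \<open>Zero-free dilations of the \<open>p n\<close> still converge to \<open>f\<close> in \<open>L\<^sup>1\<close>, and the negative parts of their
  logarithms have uniformly bounded integrals since their values at \<open>0\<close> stay away from \<open>0\<close>. Fatou's lemma
  along an almost everywhere convergent subsequence gives the same bound for \<open>f\<close>.\<close>

theorem log_integrable_L1_limit:
  assumes f: "integrable dz f" and lim: "(\<lambda>n. \<integral>z. cmod (poly (p n) z - f z) \<partial>dz) \<longlonglongrightarrow> 0"
    and b: "0 < b" "\<And>n. b \<le> cmod (poly (p n) 0)"
  shows "log_integrable f"
proof -
  interpret prob_space dz by (rule prob_space_dz)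
  have "\<exists>q. poly q 0 = poly (p n) 0 \<and> (\<forall>z\<in>circle. poly q z \<noteq> 0) \<and>
      (\<forall>z\<in>circle. cmod (poly q z - poly (p n) z) < inverse (real (Suc n)))" for n
  proof -
    have "p n \<noteq> 0" using b(1) b(2)[of n] by auto
    from exists_zero_free_dilation[OF this, of "inverse (real (Suc n))"] show ?thesis by (metis inverse_positive_iff_positive of_nat_0_less_iff zero_less_Suc)
  qed
  then obtain q where q0: "\<And>n. poly (q n) 0 = poly (p n) 0"
    and qnz: "\<And>n z. z \<in> circle \<Longrightarrow> poly (q n) z \<noteq> 0"
    and qp: "\<And>n z. z \<in> circle \<Longrightarrow> cmod (poly (q n) z - poly (p n) z) < inverse (real (Suc n))"
    by metis
  have dpi: "integrable dz (\<lambda>z. poly s z - f z)" for s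
    by (intro Bochner_Integration.integrable_diff integrable_dz_poly f)
  define e where "e = (\<lambda>n. \<integral>z. cmod (poly (q n) z - f z) \<partial>dz)"
  have le: "e n \<le> inverse (real (Suc n)) + (\<integral>z. cmod (poly (p n) z - f z) \<partial>dz)" for n
  proof -
    have "e n \<le> (\<integral>z. inverse (real (Suc n)) + cmod (poly (p n) z - f z) \<partial>dz)"
      unfolding e_def
    proof (rule integral_mono)
      fix z assume "z \<in> space dz"
      then have "cmod (poly (q n) z - poly (p n) z) < inverse (real (Suc n))" by (intro qp) simp
      then show "cmod (poly (q n) z - f z) \<le> inverse (real (Suc n)) + cmod (poly (p n) z - f z)"
        using norm_triangle_ineq[of "poly (q n) z - poly (p n) z" "poly (p n) z - f z"] by simp
    qed (use dpi in auto)
    also have "\<dots> = inverse (real (Suc n)) + (\<integral>z. cmod (poly (p n) z - f z) \<partial>dz)"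
      using dpi[of "p n"] prob_space by (simp del: space_dz)
    finally show ?thesis .
  qed
  have e0: "e \<longlonglongrightarrow> 0"
  proof (rule tendsto_sandwich[OF _ _ tendsto_const])
    show "(\<lambda>n. inverse (real (Suc n)) + (\<integral>z. cmod (poly (p n) z - f z) \<partial>dz)) \<longlonglongrightarrow> 0"
      using tendsto_add[OF LIMSEQ_inverse_real_of_nat lim] by simp
  qed (use le in \<open>auto simp: e_def\<close>)
  then obtain E where E: "\<And>n. e n \<le> E"
    by (metis Bseq_def convergentI convergent_imp_Bseq abs_le_D1 real_norm_def)
  define K where "K = (\<integral>z. cmod (f z) \<partial>dz) + E - ln b"
  have nK: "(\<integral>\<^sup>+z. neg_ln_norm (poly (q n) z) \<partial>dz) \<le> ennreal K" for n
  proof (rule order_trans[OF nn_integral_neg_ln_norm_poly_le[OF qnz b(1)]])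
    show "b \<le> cmod (poly (q n) 0)" using b(2) by (simp add: q0)
    have "(\<integral>z. cmod (poly (q n) z) \<partial>dz) \<le> (\<integral>z. cmod (f z) + cmod (poly (q n) z - f z) \<partial>dz)"
      by (rule integral_mono)
         (use f dpi in \<open>auto intro: norm_triangle_sub\<close>)
    also have "\<dots> = (\<integral>z. cmod (f z) \<partial>dz) + e n"
      using f dpi[of "q n"] by (simp add: e_def)
    finally show "ennreal ((\<integral>z. cmod (poly (q n) z) \<partial>dz) - ln b) \<le> ennreal K"
      using E[of n] by (intro ennreal_leI) (simp add: K_def)
  qed
  obtain r where r: "strict_mono r" and conv: "AE z in dz. (\<lambda>n. poly (q (r n)) z - f z) \<longlonglongrightarrow> 0"
    using tendsto_L1_AE_subseq[of dz "\<lambda>n z. poly (q n) z - f z"] dpi e0 unfolding e_def by blast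
  have fm [measurable]: "f \<in> borel_measurable dz" using f by auto
  have pm [measurable]: "(\<lambda>z. poly s z) \<in> borel_measurable dz" for s
    using integrable_dz_poly[of s] by (rule borel_measurable_integrable)
  have "(\<integral>\<^sup>+z. neg_ln_norm (f z) \<partial>dz) \<le> (\<integral>\<^sup>+z. liminf (\<lambda>n. neg_ln_norm (poly (q (r n)) z)) \<partial>dz)"
  proof (rule nn_integral_mono_AE)
    show "AE z in dz. neg_ln_norm (f z) \<le> liminf (\<lambda>n. neg_ln_norm (poly (q (r n)) z))"
      using conv
    proof eventually_elim
      case (elim z)
      then have "(\<lambda>n. poly (q (r n)) z) \<longlonglongrightarrow> f z" by (rule LIM_zero_cancel)
      then have "(\<lambda>n. neg_ln_norm (poly (q (r n)) z)) \<longlonglongrightarrow> neg_ln_norm (f z)"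
        by (intro isCont_tendsto_compose[of _ neg_ln_norm]) (simp_all add: isCont_def tendsto_neg_ln_norm)
      then show ?case by (simp add: lim_imp_Liminf)
    qed
  qed
  also have "\<dots> \<le> liminf (\<lambda>n. \<integral>\<^sup>+z. neg_ln_norm (poly (q (r n)) z) \<partial>dz)"
    by (rule nn_integral_liminf) measurable
  also have "\<dots> \<le> ennreal K"
    by (rule Liminf_le) (use nK in auto)
  finally have fin: "(\<integral>\<^sup>+z. neg_ln_norm (f z) \<partial>dz) \<le> ennreal K" .
  have nz: "AE z in dz. f z \<noteq> 0"
  proof -
    have "AE z in dz. neg_ln_norm (f z) \<noteq> \<infinity>"
      by (rule nn_integral_noteq_infinite) (use fin in \<open>auto simp: top_unique\<close>)
    then show ?thesis by eventually_elim (auto simp: neg_ln_norm_def)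
  qed
  have "integrable dz (\<lambda>z. ln (cmod (f z)))"
  proof (rule integrableI_bounded)
    show "(\<lambda>z. ln (cmod (f z))) \<in> borel_measurable dz" by measurable
    have "(\<integral>\<^sup>+z. ennreal (norm (ln (cmod (f z)))) \<partial>dz) \<le> (\<integral>\<^sup>+z. neg_ln_norm (f z) + ennreal (cmod (f z)) \<partial>dz)"
    proof (rule nn_integral_mono_AE)
      show "AE z in dz. ennreal (norm (ln (cmod (f z)))) \<le> neg_ln_norm (f z) + ennreal (cmod (f z))"
        using nz
      proof eventually_elim
        case (elim z)
        have "ennreal (norm (ln (cmod (f z)))) \<le> ennreal (max 0 (- ln (cmod (f z))) + cmod (f z))"
          using ln_le_minus_one[of "cmod (f z)"] elim by (intro ennreal_leI) (auto simp: abs_if max_def)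
        also have "\<dots> = ennreal (max 0 (- ln (cmod (f z)))) + ennreal (cmod (f z))"
          by (rule ennreal_plus) auto
        also have "ennreal (max 0 (- ln (cmod (f z)))) = neg_ln_norm (f z)"
          using elim by (auto simp: neg_ln_norm_def max_def ennreal_neg)
        finally show ?case .
      qed
    qed
    also have "\<dots> = (\<integral>\<^sup>+z. neg_ln_norm (f z) \<partial>dz) + (\<integral>\<^sup>+z. ennreal (cmod (f z)) \<partial>dz)"
      by (rule nn_integral_add) auto
    also have "\<dots> < \<infinity>"
      using fin f by (auto simp: integrable_iff_bounded less_top[symmetric] top_unique)
    finally show "(\<integral>\<^sup>+z. ennreal (norm (ln (cmod (f z)))) \<partial>dz) < \<infinity>" .
  qed
  with nz show ?thesis by (simp add: log_integrable_def)
qed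

section \<open>Completeness and bounds on dilations\<close>

text \<open>A subsequence converges almost everywhere, and by Fatou's lemma the tails of the whole sequence are
  close to its limit in \<open>L\<^sup>1\<close>.\<close>

lemma L1_cauchy_imp_convergent:
  fixes s :: "nat \<Rightarrow> 'a \<Rightarrow> complex"
  assumes s: "\<And>n. integrable M (s n)"
    and cauchy: "\<And>e. e > 0 \<Longrightarrow> \<exists>N. \<forall>i\<ge>N. \<forall>j\<ge>N. (\<integral>x. cmod (s i x - s j x) \<partial>M) < e"
  obtains f where "integrable M f" "(\<lambda>n. \<integral>x. cmod (s n x - f x) \<partial>M) \<longlonglongrightarrow> 0"
proof -
  obtain r where r: "strict_mono r" and ae: "AE x in M. Cauchy (\<lambda>i. s (r i) x)"
    using cauchy_L1_AE_cauchy_subseq[OF s cauchy] by blast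
  define f where "f = (\<lambda>x. lim (\<lambda>i. s (r i) x))"
  have sm [measurable]: "s n \<in> borel_measurable M" for n using s by auto
  have fm [measurable]: "f \<in> borel_measurable M" unfolding f_def by measurable
  have conv: "AE x in M. (\<lambda>i. s (r i) x) \<longlonglongrightarrow> f x"
    using ae unfolding f_def by eventually_elim (simp add: Cauchy_convergent_iff convergent_LIMSEQ_iff)
  have tail: "(\<integral>\<^sup>+x. cmod (s n x - f x) \<partial>M) \<le> ennreal e"
    if N: "\<forall>i\<ge>N. \<forall>j\<ge>N. (\<integral>x. cmod (s i x - s j x) \<partial>M) < e" and n: "n \<ge> N" for e N n
  proof -
    have "(\<integral>\<^sup>+x. cmod (s n x - f x) \<partial>M) \<le> (\<integral>\<^sup>+x. liminf (\<lambda>i. ennreal (cmod (s n x - s (r i) x))) \<partial>M)"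
    proof (rule nn_integral_mono_AE)
      show "AE x in M. ennreal (cmod (s n x - f x)) \<le> liminf (\<lambda>i. ennreal (cmod (s n x - s (r i) x)))"
        using conv
      proof eventually_elim
        case (elim x)
        then have "(\<lambda>i. ennreal (cmod (s n x - s (r i) x))) \<longlonglongrightarrow> ennreal (cmod (s n x - f x))"
          by (intro tendsto_ennrealI tendsto_norm tendsto_diff tendsto_const)
        from lim_imp_Liminf[OF trivial_limit_sequentially this] show ?case by (simp only: order_refl)
      qed
    qed
    also have "\<dots> \<le> liminf (\<lambda>i. \<integral>\<^sup>+x. ennreal (cmod (s n x - s (r i) x)) \<partial>M)"
      by (rule nn_integral_liminf) measurable
    also have "\<dots> \<le> ennreal e"
    proof (rule Liminf_le)
      have "\<forall>\<^sub>F i in sequentially. i \<ge> N" by (rule eventually_ge_at_top)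
      then show "\<forall>\<^sub>F i in sequentially. (\<integral>\<^sup>+x. ennreal (cmod (s n x - s (r i) x)) \<partial>M) \<le> ennreal e"
      proof eventually_elim
        case (elim i)
        then have "r i \<ge> N" using seq_suble[OF r, of i] by simp
        then have "(\<integral>x. cmod (s n x - s (r i) x) \<partial>M) \<le> e" using N n by (simp add: less_imp_le)
        moreover have "(\<integral>\<^sup>+x. ennreal (cmod (s n x - s (r i) x)) \<partial>M) = ennreal (\<integral>x. cmod (s n x - s (r i) x) \<partial>M)"
          by (rule nn_integral_eq_integral) (use s in auto)
        ultimately show ?case by (simp add: ennreal_leI)
      qed
    qed simp
    finally show ?thesis .
  qed
  have diff_int: "integrable M (\<lambda>x. s n x - f x)"
    if N: "\<forall>i\<ge>N. \<forall>j\<ge>N. (\<integral>x. cmod (s i x - s j x) \<partial>M) < e" and n: "n \<ge> N" for e N n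
    using tail[OF that] by (intro integrableI_bounded) (auto simp: less_top[symmetric] top_unique)
  have f: "integrable M f"
  proof -
    obtain N where N: "\<forall>i\<ge>N. \<forall>j\<ge>N. (\<integral>x. cmod (s i x - s j x) \<partial>M) < 1" using cauchy[of 1] by auto
    have "integrable M (\<lambda>x. s N x - (s N x - f x))"
      by (intro Bochner_Integration.integrable_diff s diff_int[OF N]) simp
    then show ?thesis by simp
  qed
  have "(\<lambda>n. \<integral>x. cmod (s n x - f x) \<partial>M) \<longlonglongrightarrow> 0"
  proof (rule LIMSEQ_I)
    fix e :: real assume e: "e > 0"
    obtain N where N: "\<forall>i\<ge>N. \<forall>j\<ge>N. (\<integral>x. cmod (s i x - s j x) \<partial>M) < e / 2" using cauchy[of "e / 2"] e by auto
    have "(\<integral>x. cmod (s n x - f x) \<partial>M) \<le> e / 2" if n: "n \<ge> N" for n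
    proof -
      have "ennreal (\<integral>x. cmod (s n x - f x) \<partial>M) = (\<integral>\<^sup>+x. cmod (s n x - f x) \<partial>M)"
        by (rule nn_integral_eq_integral[symmetric]) (use diff_int[OF N n] in auto)
      then have "ennreal (\<integral>x. cmod (s n x - f x) \<partial>M) \<le> ennreal (e / 2)"
        using tail[OF N n] by simp
      then show ?thesis using e by (subst (asm) ennreal_le_iff) auto
    qed
    then show "\<exists>N. \<forall>n\<ge>N. norm ((\<integral>x. cmod (s n x - f x) \<partial>M) - 0) < e"
      using e by (intro exI[of _ N]) fastforce
  qed
  with f show ?thesis by (rule that)
qed

lemma L2_bound_AE_limit:
  fixes g :: "nat \<Rightarrow> 'a \<Rightarrow> complex"
  assumes gm [measurable]: "\<And>n. g n \<in> borel_measurable M" "h \<in> borel_measurable M"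
    and g2: "\<And>n. integrable M (\<lambda>x. (cmod (g n x))\<^sup>2)" "\<And>n. (\<integral>x. (cmod (g n x))\<^sup>2 \<partial>M) \<le> 1"
    and conv: "AE x in M. (\<lambda>n. g n x) \<longlonglongrightarrow> h x"
  shows "integrable M (\<lambda>x. (cmod (h x))\<^sup>2)" "(\<integral>x. (cmod (h x))\<^sup>2 \<partial>M) \<le> 1"
proof -
  have "(\<integral>\<^sup>+x. ennreal ((cmod (h x))\<^sup>2) \<partial>M) \<le> (\<integral>\<^sup>+x. liminf (\<lambda>n. ennreal ((cmod (g n x))\<^sup>2)) \<partial>M)"
  proof (rule nn_integral_mono_AE)
    show "AE x in M. ennreal ((cmod (h x))\<^sup>2) \<le> liminf (\<lambda>n. ennreal ((cmod (g n x))\<^sup>2))"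
      using conv
    proof eventually_elim
      case (elim x)
      then have "(\<lambda>n. ennreal ((cmod (g n x))\<^sup>2)) \<longlonglongrightarrow> ennreal ((cmod (h x))\<^sup>2)"
        by (intro tendsto_ennrealI tendsto_power tendsto_norm)
      from lim_imp_Liminf[OF trivial_limit_sequentially this] show ?case by (simp only: order_refl)
    qed
  qed
  also have "\<dots> \<le> liminf (\<lambda>n. \<integral>\<^sup>+x. ennreal ((cmod (g n x))\<^sup>2) \<partial>M)"
    by (rule nn_integral_liminf) measurable
  also have "\<dots> \<le> 1"
  proof (rule Liminf_le[OF trivial_limit_sequentially always_eventually], intro allI)
    fix n
    have "(\<integral>\<^sup>+x. ennreal ((cmod (g n x))\<^sup>2) \<partial>M) = ennreal (\<integral>x. (cmod (g n x))\<^sup>2 \<partial>M)"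
      by (rule nn_integral_eq_integral[OF g2(1)]) simp
    also have "\<dots> \<le> ennreal 1" by (rule ennreal_leI[OF g2(2)])
    finally show "(\<integral>\<^sup>+x. ennreal ((cmod (g n x))\<^sup>2) \<partial>M) \<le> 1" by simp
  qed
  finally have le: "(\<integral>\<^sup>+x. ennreal ((cmod (h x))\<^sup>2) \<partial>M) \<le> 1" .
  show i: "integrable M (\<lambda>x. (cmod (h x))\<^sup>2)"
  proof (rule integrableI_bounded)
    show "(\<lambda>x. (cmod (h x))\<^sup>2) \<in> borel_measurable M" by measurable
    show "(\<integral>\<^sup>+x. ennreal (norm ((cmod (h x))\<^sup>2)) \<partial>M) < \<infinity>"
      using le_less_trans[OF le ennreal_one_less_top] by simp
  qed
  have "ennreal (\<integral>x. (cmod (h x))\<^sup>2 \<partial>M) \<le> ennreal 1"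
    using le nn_integral_eq_integral[OF i] by simp
  then show "(\<integral>x. (cmod (h x))\<^sup>2 \<partial>M) \<le> 1" by (subst (asm) ennreal_le_iff) auto
qed

lemma continuous_on_hardy_extension_dilation:
  assumes f: "integrable dz f" and r: "0 \<le> r" "r < 1"
  shows "continuous_on circle (\<lambda>z. hardy_extension f (of_real r * z))"
proof (rule continuous_on_compose2[OF holomorphic_on_imp_continuous_on[OF holomorphic_hardy_extension[OF f]],
      of circle "\<lambda>z. of_real r * z"])
  show "continuous_on circle (\<lambda>z. complex_of_real r * z)"
    by (rule continuous_on_mult[OF continuous_on_const continuous_on_id])
  show "(\<lambda>z. complex_of_real r * z) ` circle \<subseteq> ball 0 1"
    using r by (auto simp: circle_def norm_mult)
qed

lemma continuous_on_poly_dilation: "continuous_on circle (\<lambda>z. poly s (of_real r * z))"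
  by (rule continuous_on_poly[OF continuous_on_mult[OF continuous_on_const continuous_on_id]])

text \<open>Replace \<open>f\<close> by \<open>p n\<close>, where the contraction property of dilations applies to the polynomial
  \<open>s - p n\<close>, and let \<open>n\<close> tend to infinity with \<open>r\<close> fixed.\<close>

lemma integral_norm_poly_minus_extension_dilation_le:
  assumes f: "integrable dz f" and lim: "(\<lambda>n. \<integral>z. cmod (poly (p n) z - f z) \<partial>dz) \<longlonglongrightarrow> 0"
    and r: "0 \<le> r" "r < 1"
  shows "(\<integral>z. cmod (poly s (of_real r * z) - hardy_extension f (of_real r * z)) \<partial>dz) \<le> (\<integral>z. cmod (poly s z - f z) \<partial>dz)"
proof -
  interpret prob_space dz by (rule prob_space_dz)
  define e where "e = (\<lambda>n. \<integral>z. cmod (poly (p n) z - f z) \<partial>dz)"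
  define L where "L = (\<integral>z. cmod (poly s (of_real r * z) - hardy_extension f (of_real r * z)) \<partial>dz)"
  have dpi: "integrable dz (\<lambda>z. poly q z - f z)" for q
    by (intro Bochner_Integration.integrable_diff integrable_dz_poly f)
  have le: "L \<le> ((\<integral>z. cmod (poly s z - f z) \<partial>dz) + e n) + e n / (1 - r)" for n
  proof -
    have i1: "integrable dz (\<lambda>z. cmod (poly (s - p n) (of_real r * z)))"
      by (intro integrable_norm integrable_dz_continuous continuous_on_poly_dilation)
    have "L \<le> (\<integral>z. cmod (poly (s - p n) (of_real r * z)) + e n / (1 - r) \<partial>dz)"
      unfolding L_def
    proof (rule integral_mono)
      show "integrable dz (\<lambda>z. cmod (poly s (of_real r * z) - hardy_extension f (of_real r * z)))"
        by (intro integrable_norm integrable_dz_continuous continuous_on_diff continuous_on_poly_dilation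
            continuous_on_hardy_extension_dilation f r)
      fix z assume "z \<in> space dz"
      then have "cmod (of_real r * z) = r" using r by (simp add: circle_def norm_mult)
      then have "cmod (poly (p n) (of_real r * z) - hardy_extension f (of_real r * z)) \<le> e n / (1 - r)"
        using norm_poly_minus_hardy_extension_le[OF f, of "of_real r * z" "p n"] r by (simp add: e_def)
      then show "cmod (poly s (of_real r * z) - hardy_extension f (of_real r * z)) \<le>
          cmod (poly (s - p n) (of_real r * z)) + e n / (1 - r)"
        using norm_triangle_ineq[of "poly (s - p n) (of_real r * z)" "poly (p n) (of_real r * z) - hardy_extension f (of_real r * z)"]
        by simp
    qed (use i1 in simp)
    also have "\<dots> = (\<integral>z. cmod (poly (s - p n) (of_real r * z)) \<partial>dz) + e n / (1 - r)"
      using i1 prob_space by (simp del: space_dz poly_diff)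
    also have "(\<integral>z. cmod (poly (s - p n) (of_real r * z)) \<partial>dz) \<le> (\<integral>z. cmod (poly (s - p n) z) \<partial>dz)"
      by (rule integral_norm_poly_dilation_le[OF r])
    also have "(\<integral>z. cmod (poly (s - p n) z) \<partial>dz) \<le> (\<integral>z. cmod (poly s z - f z) + cmod (poly (p n) z - f z) \<partial>dz)"
    proof (rule integral_mono)
      show "cmod (poly (s - p n) z) \<le> cmod (poly s z - f z) + cmod (poly (p n) z - f z)" for z
        using norm_triangle_ineq4[of "poly s z - f z" "poly (p n) z - f z"] by simp
      show "integrable dz (\<lambda>z. cmod (poly (s - p n) z))" by (rule integrable_norm[OF integrable_dz_poly])
    qed (use dpi in auto)
    also have "\<dots> = (\<integral>z. cmod (poly s z - f z) \<partial>dz) + e n"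
      using dpi by (simp add: e_def)
    finally show ?thesis by simp
  qed
  have "(\<lambda>n. ((\<integral>z. cmod (poly s z - f z) \<partial>dz) + e n) + e n / (1 - r)) \<longlonglongrightarrow> ((\<integral>z. cmod (poly s z - f z) \<partial>dz) + 0) + 0 / (1 - r)"
    using lim r by (intro tendsto_intros) (auto simp: e_def)
  from LIMSEQ_le_const[OF this, of L] le show ?thesis by (auto simp: L_def)
qed

text \<open>By Parseval's identity, since dilation multiplies the coefficients by powers of \<open>r\<close>.\<close>

lemma L2_norm_poly_dilation_le:
  assumes "0 \<le> r" "r < 1"
  shows "(\<integral>z. (cmod (poly p (of_real r * z)))\<^sup>2 \<partial>dz) \<le> (\<integral>z. (cmod (poly p z))\<^sup>2 \<partial>dz)"
proof -
  let ?q = "pcompose p [:0, of_real r:]"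
  have "(\<integral>z. (cmod (poly p (of_real r * z)))\<^sup>2 \<partial>dz) = (\<integral>z. (cmod (poly ?q z))\<^sup>2 \<partial>dz)"
    by (simp add: poly_pcompose mult.commute)
  also have "\<dots> = (\<Sum>i\<le>degree ?q. (cmod (coeff ?q i))\<^sup>2)" by (rule parseval_poly)
  also have "\<dots> \<le> (\<Sum>i\<le>degree ?q. (cmod (coeff p i))\<^sup>2)"
  proof (intro sum_mono power_mono)
    fix i
    have "\<bar>r\<bar> ^ i * cmod (coeff p i) \<le> 1 * cmod (coeff p i)"
      using assms by (intro mult_right_mono power_le_one) auto
    then show "cmod (coeff ?q i) \<le> cmod (coeff p i)"
      by (simp add: coeff_pcompose_linear norm_mult norm_power)
  qed simp
  also have "\<dots> \<le> (\<integral>z. (cmod (poly p z))\<^sup>2 \<partial>dz)"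
    using sum_coeff_squares_le_integral[where N = "Suc (degree ?q)"] by (simp only: lessThan_Suc_atMost)
  finally show ?thesis .
qed

lemma L2_norm_hardy_extension_dilation_le:
  assumes f: "integrable dz f" and lim: "(\<lambda>n. \<integral>z. cmod (poly (p n) z - f z) \<partial>dz) \<longlonglongrightarrow> 0"
    and p: "\<And>n. (\<integral>z. (cmod (poly (p n) z))\<^sup>2 \<partial>dz) \<le> 1" and r: "0 \<le> r" "r < 1"
  shows "(\<integral>z. (cmod (hardy_extension f (of_real r * z)))\<^sup>2 \<partial>dz) \<le> 1"
proof (rule L2_bound_AE_limit(2)[where g = "\<lambda>n z. poly (p n) (of_real r * z)"])
  show "(\<lambda>z. poly (p n) (of_real r * z)) \<in> borel_measurable dz" for n
    by (rule borel_measurable_dz_continuous[OF continuous_on_poly_dilation])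
  show "(\<lambda>z. hardy_extension f (of_real r * z)) \<in> borel_measurable dz"
    by (rule borel_measurable_dz_continuous[OF continuous_on_hardy_extension_dilation[OF f r]])
  show "integrable dz (\<lambda>z. (cmod (poly (p n) (of_real r * z)))\<^sup>2)" for n
    by (intro integrable_dz_continuous continuous_on_power continuous_on_norm continuous_on_poly_dilation)
  show "(\<integral>z. (cmod (poly (p n) (of_real r * z)))\<^sup>2 \<partial>dz) \<le> 1" for n
    by (rule order_trans[OF L2_norm_poly_dilation_le[OF r] p])
  show "AE z in dz. (\<lambda>n. poly (p n) (of_real r * z)) \<longlonglongrightarrow> hardy_extension f (of_real r * z)"
  proof (rule AE_I2)
    fix z assume "z \<in> space dz"
    then have z: "cmod (of_real r * z) = r" using r by (simp add: circle_def norm_mult)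
    have le: "cmod (poly (p n) (of_real r * z) - hardy_extension f (of_real r * z)) \<le>
        (\<integral>z. cmod (poly (p n) z - f z) \<partial>dz) / (1 - r)" for n
      using norm_poly_minus_hardy_extension_le[OF f, of "of_real r * z" "p n"] r z by simp
    have "(\<lambda>n. (\<integral>z. cmod (poly (p n) z - f z) \<partial>dz) / (1 - r)) \<longlonglongrightarrow> 0 / (1 - r)"
      using lim r by (intro tendsto_intros) auto
    then have "(\<lambda>n. (\<integral>z. cmod (poly (p n) z - f z) \<partial>dz) / (1 - r)) \<longlonglongrightarrow> 0" by simp
    then have "(\<lambda>n. poly (p n) (of_real r * z) - hardy_extension f (of_real r * z)) \<longlonglongrightarrow> 0"
      by (rule Lim_null_comparison[rotated]) (use le in simp)
    then show "(\<lambda>n. poly (p n) (of_real r * z)) \<longlonglongrightarrow> hardy_extension f (of_real r * z)"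
      by (rule LIM_zero_cancel)
  qed
qed

lemma L1_limit_in_L2:
  assumes f: "integrable dz f" and lim: "(\<lambda>n. \<integral>z. cmod (poly (p n) z - f z) \<partial>dz) \<longlonglongrightarrow> 0"
    and p: "\<And>n. (\<integral>z. (cmod (poly (p n) z))\<^sup>2 \<partial>dz) \<le> 1"
  shows "f \<in> Lp_circle 2"
proof -
  obtain r where conv: "AE z in dz. (\<lambda>n. poly (p (r n)) z - f z) \<longlonglongrightarrow> 0"
    using tendsto_L1_AE_subseq[of dz "\<lambda>n z. poly (p n) z - f z"] lim f by auto
  have "AE z in dz. (\<lambda>n. poly (p (r n)) z) \<longlonglongrightarrow> f z"
    using conv by eventually_elim (rule LIM_zero_cancel)
  then have "integrable dz (\<lambda>z. (cmod (f z))\<^sup>2)"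
    by (rule L2_bound_AE_limit(1)[OF borel_measurable_integrable[OF integrable_dz_poly]
        borel_measurable_integrable[OF f] integrable_dz_norm_poly_power p])
  then show ?thesis using f by (simp add: L2_circle_iff)
qed

section \<open>Products of polynomials in the unit ball\<close>

lemma sum_products_tail_le:
  fixes x y :: "nat \<Rightarrow> real"
  assumes x: "\<And>D. (\<Sum>i<D. (x i)\<^sup>2) \<le> 1" and y: "\<And>D. (\<Sum>i\<in>{N..<D}. (y i)\<^sup>2) \<le> \<epsilon>\<^sup>2" and \<epsilon>: "0 \<le> \<epsilon>"
  shows "(\<Sum>i\<in>{N..<D}. x i * y i) \<le> \<epsilon>"
proof -
  have "(\<Sum>i\<in>{N..<D}. (x i)\<^sup>2) \<le> (\<Sum>i<D. (x i)\<^sup>2)" by (intro sum_mono2) auto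
  then have x1: "(\<Sum>i\<in>{N..<D}. (x i)\<^sup>2) \<le> 1" using x[of D] by linarith
  have "(\<Sum>i\<in>{N..<D}. x i * y i)\<^sup>2 \<le> (\<Sum>i\<in>{N..<D}. (x i)\<^sup>2) * (\<Sum>i\<in>{N..<D}. (y i)\<^sup>2)"
    by (rule Cauchy_Schwarz_ineq_sum)
  also have "\<dots> \<le> 1 * \<epsilon>\<^sup>2" by (intro mult_mono x1 y sum_nonneg) auto
  finally have "(\<Sum>i\<in>{N..<D}. x i * y i)\<^sup>2 \<le> \<epsilon>\<^sup>2" unfolding mult_1 .
  then show ?thesis using \<epsilon> by (rule power2_le_imp_le)
qed

text \<open>Pair with \<open>g\<close> in terms of coefficients. The first \<open>N\<close> terms tend to \<open>0\<close>; by Bessel's inequality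
  the coefficients of \<open>g\<close> beyond \<open>N\<close> have small square sum, so the rest is small uniformly in \<open>n\<close>.\<close>

lemma weakly_tendsto_zero_if_coeffs_tendsto_zero:
  assumes bound: "\<And>n. (\<integral>z. (cmod (poly (p n) z))\<^sup>2 \<partial>dz) \<le> 1"
    and coeffs: "\<And>k. (\<lambda>n. coeff (p n) k) \<longlonglongrightarrow> 0"
  shows "weakly_tendsto_L2 (\<lambda>n. poly (p n)) (\<lambda>_. 0)"
  unfolding weakly_tendsto_L2_def
proof (intro conjI allI ballI)
  have polym: "(\<lambda>z. poly q z) \<in> borel_measurable dz" for q
    by (rule borel_measurable_integrable[OF integrable_dz_poly])
  show "poly (p n) \<in> Lp_circle 2" for n
    unfolding L2_circle_iff using polym integrable_dz_norm_poly_power by simp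
  show "(\<lambda>_. 0) \<in> Lp_circle 2" by (simp add: L2_circle_iff)
  fix g assume g: "g \<in> Lp_circle 2"
  define G where "G = (\<lambda>i. cmod (\<integral>z. g z * cnj z ^ i \<partial>dz))"
  have gi: "integrable dz g" by (rule L2_circle_imp_integrable[OF g])
  have summ: "summable (\<lambda>i. (G i)\<^sup>2)"
    by (rule summableI_nonneg_bounded[where x = "\<integral>z. (cmod (g z))\<^sup>2 \<partial>dz"])
       (use bessel_inequality[OF g] in \<open>auto simp: G_def\<close>)
  have pair: "cmod (\<integral>z. poly (p n) z * cnj (g z) \<partial>dz) \<le> (\<Sum>i<max N (Suc (degree (p n))). cmod (coeff (p n) i) * G i)" for n N
  proof -
    have "(\<integral>z. poly (p n) z * cnj (g z) \<partial>dz) = (\<integral>z. cnj (g z * cnj (poly (p n) z)) \<partial>dz)"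
      by (simp add: mult.commute)
    also have "\<dots> = cnj (\<integral>z. g z * cnj (poly (p n) z) \<partial>dz)" by (rule Bochner_Integration.integral_cnj)
    finally have "cmod (\<integral>z. poly (p n) z * cnj (g z) \<partial>dz) = cmod (\<integral>z. g z * cnj (poly (p n) z) \<partial>dz)"
      by (simp only: complex_mod_cnj)
    also have "\<dots> \<le> (\<Sum>i\<le>degree (p n). cmod (coeff (p n) i) * G i)"
      unfolding integral_times_cnj_poly[OF gi] G_def
      by (rule sum_norm_le) (simp add: norm_mult)
    also have "\<dots> \<le> (\<Sum>i<max N (Suc (degree (p n))). cmod (coeff (p n) i) * G i)"
      by (intro sum_mono2) (auto simp: G_def)
    finally show ?thesis .
  qed
  have "(\<lambda>n. \<integral>z. poly (p n) z * cnj (g z) \<partial>dz) \<longlonglongrightarrow> 0"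
  proof (rule LIMSEQ_I)
    fix e :: real assume e: "e > 0"
    obtain N where N: "\<And>m n. m \<ge> N \<Longrightarrow> norm (\<Sum>i\<in>{m..<n}. (G i)\<^sup>2) < (e / 2)\<^sup>2"
      using summ e unfolding summable_Cauchy by (meson half_gt_zero zero_less_power)
    have tail: "(\<Sum>i\<in>{N..<D}. cmod (coeff (p n) i) * G i) \<le> e / 2" for n D
    proof (rule sum_products_tail_le)
      show "(\<Sum>i<D. (cmod (coeff (p n) i))\<^sup>2) \<le> 1" for D
        by (rule order_trans[OF sum_coeff_squares_le_integral bound])
      show "(\<Sum>i\<in>{N..<D}. (G i)\<^sup>2) \<le> (e / 2)\<^sup>2" for D using N[of N D] by simp
    qed (use e in simp)
    have "(\<lambda>n. \<Sum>i<N. cmod (coeff (p n) i) * G i) \<longlonglongrightarrow> (\<Sum>i<N. cmod 0 * G i)"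
      by (intro tendsto_sum tendsto_mult tendsto_norm coeffs tendsto_const)
    then have "\<forall>\<^sub>F n in sequentially. (\<Sum>i<N. cmod (coeff (p n) i) * G i) < e / 2"
      using e by (intro order_tendstoD(2)) auto
    then obtain n0 where n0: "\<And>n. n \<ge> n0 \<Longrightarrow> (\<Sum>i<N. cmod (coeff (p n) i) * G i) < e / 2"
      by (auto simp: eventually_sequentially)
    show "\<exists>n0. \<forall>n\<ge>n0. norm ((\<integral>z. poly (p n) z * cnj (g z) \<partial>dz) - 0) < e"
    proof (intro exI allI impI)
      fix n assume n: "n \<ge> n0"
      define D where "D = max N (Suc (degree (p n)))"
      have "(\<Sum>i<D. cmod (coeff (p n) i) * G i) =
          (\<Sum>i<N. cmod (coeff (p n) i) * G i) + (\<Sum>i\<in>{N..<D}. cmod (coeff (p n) i) * G i)"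
        using sum.atLeastLessThan_concat[of 0 N D "\<lambda>i. cmod (coeff (p n) i) * G i"]
        by (simp add: D_def lessThan_atLeast0)
      then show "norm ((\<integral>z. poly (p n) z * cnj (g z) \<partial>dz) - 0) < e"
        using pair[of n N] tail[of n D] n0[OF n] by (simp add: D_def)
    qed
  qed
  then show "(\<lambda>n. \<integral>z. poly (p n) z * cnj (g z) \<partial>dz) \<longlonglongrightarrow> (\<integral>z. 0 * cnj (g z) \<partial>dz)" by simp
qed

text \<open>Think of \<open>Q m n\<close> as the product of the factors with indices from \<open>m\<close> to \<open>n - 1\<close>. In the Cauchy
  product for \<open>Q m n = Q m l * Q l n\<close> the leading term is at most \<open>\<bar>coeff (Q m l) 0\<bar>\<close>, which is small for a
  suitable fixed \<open>l\<close>. The other terms contain coefficients of \<open>Q l n\<close> of lower degree, which tend to \<open>0\<close>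
  by induction; this is why the claim is proved for all tails at once.\<close>

lemma coeffs_of_tails_tendsto_zero:
  fixes Q :: "nat \<Rightarrow> nat \<Rightarrow> complex poly"
  assumes mult: "\<And>m l n. m \<le> l \<Longrightarrow> l \<le> n \<Longrightarrow> Q m n = Q m l * Q l n"
    and bound: "\<And>m n k. m \<le> n \<Longrightarrow> cmod (coeff (Q m n) k) \<le> 1"
    and const: "\<And>m. (\<lambda>n. coeff (Q m n) 0) \<longlonglongrightarrow> 0"
  shows "(\<lambda>n. coeff (Q m n) d) \<longlonglongrightarrow> 0"
proof (induction d arbitrary: m rule: less_induct)
  case (less d)
  show ?case
  proof (rule LIMSEQ_I)
    fix e :: real assume e: "e > 0"
    have "\<forall>\<^sub>F l in sequentially. cmod (coeff (Q m l) 0) < e / 2"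
      by (rule order_tendstoD(2)[OF tendsto_norm_zero[OF const]]) (use e in simp)
    then obtain l0 where l0: "\<And>l. l \<ge> l0 \<Longrightarrow> cmod (coeff (Q m l) 0) < e / 2"
      unfolding eventually_sequentially by blast
    define l where "l = max m l0"
    have l: "m \<le> l" "cmod (coeff (Q m l) 0) < e / 2" using l0[of l] by (simp_all add: l_def)
    have "(\<lambda>n. \<Sum>i\<in>{0<..d}. cmod (coeff (Q m l) i * coeff (Q l n) (d - i))) \<longlonglongrightarrow> (\<Sum>i\<in>{0<..d}. cmod (coeff (Q m l) i * 0))"
      by (intro tendsto_sum tendsto_norm tendsto_mult tendsto_const less.IH) auto
    then have "\<forall>\<^sub>F n in sequentially. (\<Sum>i\<in>{0<..d}. cmod (coeff (Q m l) i * coeff (Q l n) (d - i))) < e / 2"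
      by (rule order_tendstoD(2)) (use e in simp)
    then obtain n0 where n0: "\<And>n. n \<ge> n0 \<Longrightarrow> (\<Sum>i\<in>{0<..d}. cmod (coeff (Q m l) i * coeff (Q l n) (d - i))) < e / 2"
      unfolding eventually_sequentially by blast
    show "\<exists>n0. \<forall>n\<ge>n0. norm (coeff (Q m n) d - 0) < e"
    proof (intro exI allI impI)
      fix n assume n: "n \<ge> max l n0"
      have "coeff (Q m n) d = (\<Sum>i\<le>d. coeff (Q m l) i * coeff (Q l n) (d - i))"
        using mult[of m l n] l n by (simp add: coeff_mult)
      also have "{..d} = insert 0 {0<..d}" by auto
      finally have "coeff (Q m n) d = coeff (Q m l) 0 * coeff (Q l n) d + (\<Sum>i\<in>{0<..d}. coeff (Q m l) i * coeff (Q l n) (d - i))"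
        by simp
      moreover have "cmod (coeff (Q m l) 0 * coeff (Q l n) d) \<le> cmod (coeff (Q m l) 0) * 1"
        unfolding norm_mult using bound[of l n d] n by (intro mult_left_mono) auto
      moreover have "cmod (\<Sum>i\<in>{0<..d}. coeff (Q m l) i * coeff (Q l n) (d - i)) \<le>
          (\<Sum>i\<in>{0<..d}. cmod (coeff (Q m l) i * coeff (Q l n) (d - i)))" by (rule norm_sum)
      ultimately show "norm (coeff (Q m n) d - 0) < e"
        using norm_triangle_ineq[of "coeff (Q m l) 0 * coeff (Q l n) d"
            "\<Sum>i\<in>{0<..d}. coeff (Q m l) i * coeff (Q l n) (d - i)"] l(2) n0[of n] n by simp
    qed
  qed
qed

text \<open>Since \<open>q\<close> lies in the unit ball and has mean \<open>c\<close>, \<open>\<parallel>q - 1\<parallel>\<^sup>2 = \<parallel>q\<parallel>\<^sup>2 - 2 * c + 1 \<le> 2 * (1 - c)\<close>. The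
  factor \<open>s\<close> is removed by the Cauchy--Schwarz inequality, which explains why the bound is in \<open>L\<^sup>1\<close>.\<close>

lemma L1_dist_product_le:
  assumes S: "(\<integral>z. (cmod (poly s z))\<^sup>2 \<partial>dz) \<le> 1" and Q: "(\<integral>z. (cmod (poly q z))\<^sup>2 \<partial>dz) \<le> 1"
    and q0: "coeff q 0 = of_real c"
  shows "(\<integral>z. cmod (poly (s * q) z - poly s z) \<partial>dz) \<le> sqrt (2 * (1 - c))"
proof -
  interpret prob_space dz by (rule prob_space_dz)
  have "(\<integral>z. (cmod (poly (q - 1) z))\<^sup>2 \<partial>dz) =
      (\<integral>z. (cmod (poly q z))\<^sup>2 - 2 * Re (poly q z) + 1 \<partial>dz)"
    using cmod_diff_power2[of _ 1] by simp
  also have "\<dots> = (\<integral>z. (cmod (poly q z))\<^sup>2 \<partial>dz) - 2 * c + 1"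
  proof -
    have "(\<integral>z. poly q z \<partial>dz) = of_real c" using integral_poly_cnj_power[of q 0] q0 by simp
    then have "(\<integral>z. Re (poly q z) \<partial>dz) = c" using integral_Re[OF integrable_dz_poly[of q]] by simp
    then show ?thesis
      using integrable_dz_norm_poly_power[of q 2] integrable_Re[OF integrable_dz_poly[of q]] prob_space
      by (simp del: space_dz)
  qed
  also have "\<dots> \<le> 2 * (1 - c)" using Q by simp
  finally have q1: "(\<integral>z. (cmod (poly (q - 1) z))\<^sup>2 \<partial>dz) \<le> 2 * (1 - c)" .
  have eq: "cmod (poly (s * q) z - poly s z) = cmod (poly s z) * cmod (poly (q - 1) z)" for z
    by (simp add: norm_mult[symmetric] algebra_simps)
  have "(\<integral>z. cmod (poly (s * q) z - poly s z) \<partial>dz)\<^sup>2 \<le> (\<integral>z. (cmod (poly (q - 1) z))\<^sup>2 \<partial>dz)"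
    unfolding eq
  proof (rule power2_integral_mult_le)
    show "integrable dz (\<lambda>z. cmod (poly s z) * cmod (poly (q - 1) z))"
      by (intro integrable_dz_continuous continuous_on_mult continuous_on_norm continuous_on_poly_complex)
  qed (rule integrable_dz_norm_poly_power S)+
  then show ?thesis using q1 by (intro real_le_rsqrt) linarith
qed

section \<open>Limits in the Hardy spaces\<close>

lemma Lp_norm_1: "Lp_norm 1 g = (\<integral>z. cmod (g z) \<partial>dz)"
  by (simp add: Lp_norm_def)

lemma Lp_norm_2: "Lp_norm 2 g = sqrt (\<integral>z. (cmod (g z))\<^sup>2 \<partial>dz)"
  by (simp add: Lp_norm_def powr_half_sqrt)

lemma Lp_circle_1: "f \<in> Lp_circle 1 \<longleftrightarrow> integrable dz f"
proof
  assume "f \<in> Lp_circle 1"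
  then have "f \<in> borel_measurable dz" "integrable dz (\<lambda>z. cmod (f z))" by (auto simp: Lp_circle_def)
  then show "integrable dz f" by (simp only: integrable_norm_iff)
next
  assume f: "integrable dz f"
  then show "f \<in> Lp_circle 1" using integrable_norm[OF f] borel_measurable_integrable[OF f] by (simp add: Lp_circle_def)
qed

text \<open>The boundedness statement makes the supremum in the norm meaningful.\<close>

lemma hardy_norm_le:
  assumes "\<And>r. 0 \<le> r \<Longrightarrow> r < 1 \<Longrightarrow> Lp_norm q (\<lambda>z. F (of_real r * z)) \<le> B"
  shows "bdd_above ((\<lambda>r. Lp_norm q (\<lambda>z. F (of_real r * z))) ` {0..<1})" "hardy_norm q F \<le> B"
  using assms by (auto simp: hardy_norm_def intro!: bdd_aboveI[where M = B] cSUP_least)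

theorem H1_limit_properties:
  assumes f: "integrable dz f" and lim: "(\<lambda>n. \<integral>z. cmod (poly (p n) z - f z) \<partial>dz) \<longlonglongrightarrow> 0"
  shows "hardy_boundary 1 (hardy_extension f) f"
    and "(\<lambda>n. hardy_norm 1 (\<lambda>z. poly (p n) z - hardy_extension f z)) \<longlonglongrightarrow> 0"
proof -
  note dil = integral_norm_poly_minus_extension_dilation_le[OF f lim]
  have "Lp_norm 1 (\<lambda>z. hardy_extension f (of_real r * z)) \<le> (\<integral>z. cmod (f z) \<partial>dz)" if "0 \<le> r" "r < 1" for r
    using dil[OF that, of 0] by (simp add: Lp_norm_1)
  from hardy_norm_le(1)[OF this]
  have "hardy_extension f \<in> hardy_space 1"
    using holomorphic_hardy_extension[OF f] by (simp add: hardy_space_def)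
  then show "hardy_boundary 1 (hardy_extension f) f"
    using radial_limits_of_hardy_extension[OF f lim] f by (simp add: hardy_boundary_def Lp_circle_1)
  have up: "Lp_norm 1 (\<lambda>z. poly (p n) (of_real r * z) - hardy_extension f (of_real r * z)) \<le> (\<integral>z. cmod (poly (p n) z - f z) \<partial>dz)"
    if "0 \<le> r" "r < 1" for r n
    using dil[OF that, of "p n"] by (simp add: Lp_norm_1)
  note hn = hardy_norm_le[of 1 "\<lambda>z. poly (p n) z - hardy_extension f z" for n, OF up]
  have "0 \<le> hardy_norm 1 (\<lambda>z. poly (p n) z - hardy_extension f z)" for n
  proof -
    have "0 \<le> Lp_norm 1 (\<lambda>z. poly (p n) (of_real 0 * z) - hardy_extension f (of_real 0 * z))"
      unfolding Lp_norm_1 by simp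
    also have "\<dots> \<le> hardy_norm 1 (\<lambda>z. poly (p n) z - hardy_extension f z)"
      unfolding hardy_norm_def by (rule cSUP_upper[OF _ hn(1)]) simp
    finally show ?thesis .
  qed
  then show "(\<lambda>n. hardy_norm 1 (\<lambda>z. poly (p n) z - hardy_extension f z)) \<longlonglongrightarrow> 0"
    by (intro tendsto_sandwich[OF _ _ tendsto_const lim] always_eventually allI hn(2))
qed

theorem H2_limit_properties:
  assumes f: "integrable dz f" and lim: "(\<lambda>n. \<integral>z. cmod (poly (p n) z - f z) \<partial>dz) \<longlonglongrightarrow> 0"
    and p: "\<And>n. (\<integral>z. (cmod (poly (p n) z))\<^sup>2 \<partial>dz) \<le> 1"
  shows "hardy_boundary 2 (hardy_extension f) f" "hardy_norm 2 (hardy_extension f) \<le> 1"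
proof -
  have "Lp_norm 2 (\<lambda>z. hardy_extension f (of_real r * z)) \<le> 1" if "0 \<le> r" "r < 1" for r
    using L2_norm_hardy_extension_dilation_le[OF f lim p that] by (simp add: Lp_norm_2)
  note hn = hardy_norm_le[OF this]
  show "hardy_norm 2 (hardy_extension f) \<le> 1" by (rule hn(2))
  have "hardy_extension f \<in> hardy_space 2"
    using holomorphic_hardy_extension[OF f] hn(1) by (simp add: hardy_space_def)
  then show "hardy_boundary 2 (hardy_extension f) f"
    using radial_limits_of_hardy_extension[OF f lim] L1_limit_in_L2[OF f lim p] by (simp add: hardy_boundary_def)
qed

section \<open>Generalized Riesz products\<close>

theorem theorem2p2:
  fixes P :: "nat \<Rightarrow> complex poly" and a :: "nat \<Rightarrow> real"
    and \<mu> :: "complex measure" and S :: "nat \<Rightarrow> complex poly"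
  assumes riesz: "generalized_riesz_product (\<lambda>j. poly (P j)) \<mu>"
    and const_term: "\<And>j. coeff (P j) 0 = complex_of_real (a j)"
    and pos: "\<And>j. a j > 0"
    and S_def: "\<And>n. S n = (\<Prod>j<n. P j)"
  shows "\<exists>b\<in>{0..1}. (\<lambda>n. \<Prod>j<n. a j) \<longlonglongrightarrow> b \<and>
    (b = 0 \<longrightarrow> weakly_tendsto_L2 (\<lambda>n. poly (S n)) (\<lambda>_. 0)) \<and>
    (b > 0 \<longrightarrow>
      (\<exists>f F.
         f \<in> Lp_circle 1 \<and>
         (\<lambda>n. Lp_norm 1 (\<lambda>z. poly (S n) z - f z)) \<longlonglongrightarrow> 0 \<and>
         hardy_boundary 1 F f \<and>
         (\<lambda>n. hardy_norm 1 (\<lambda>z. poly (S n) z - F z)) \<longlonglongrightarrow> 0 \<and>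
         \<not> (AE z in dz. f z = 0) \<and>
         hardy_boundary 2 F f \<and> hardy_norm 2 F \<le> 1 \<and>
         log_integrable f))"
proof -
  define Q where "Q = (\<lambda>m n. \<Prod>j\<in>{m..<n}. P j)"
  define A where "A = (\<lambda>n. \<Prod>j<n. a j)"
  have Q_mult: "Q m n = Q m l * Q l n" if "m \<le> l" "l \<le> n" for m l n
    unfolding Q_def by (rule prod.atLeastLessThan_concat[OF that, symmetric])
  have Q_norm: "(\<integral>z. (cmod (poly (Q m n) z))\<^sup>2 \<partial>dz) \<le> 1" for m n
  proof (cases "m < n")
    case True
    have "(\<integral>z. (cmod (\<Prod>i\<in>{m..<n}. poly (P i) z))\<^sup>2 \<partial>dz) = 1"
      using riesz True unfolding generalized_riesz_product_def defines_generalized_riesz_product_def by simp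
    then show ?thesis by (simp add: Q_def poly_prod)
  next
    case False
    then show ?thesis using prob_space.prob_space[OF prob_space_dz] by (simp add: Q_def del: space_dz)
  qed
  have Q_coeff: "cmod (coeff (Q m n) k) \<le> 1" for m n k
    using order_trans[OF norm_coeff_le_L2 Q_norm, of m n k] by (simp add: power_le_one_iff abs_square_le_1)
  have Q_const: "coeff (Q m n) 0 = of_real (\<Prod>j\<in>{m..<n}. a j)" for m n
    using const_term by (simp add: Q_def poly_prod poly_0_coeff_0[symmetric])
  have S_Q: "S n = Q 0 n" for n by (simp add: S_def Q_def lessThan_atLeast0)
  have A_mult: "A n = A m * (\<Prod>j\<in>{m..<n}. a j)" if "m \<le> n" for m n
    unfolding A_def lessThan_atLeast0 by (rule prod.atLeastLessThan_concat[OF _ that, symmetric]) simp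
  have A_pos: "A n > 0" for n unfolding A_def by (intro prod_pos ballI pos)
  have a_le: "a j \<le> 1" for j
  proof -
    \<comment> \<open>a single factor is the block \<open>Q j (Suc j)\<close>\<close>
    have "coeff (Q j (Suc j)) 0 = of_real (a j)" by (simp add: Q_const)
    then show ?thesis using Q_coeff[of j "Suc j" 0] pos[of j] by simp
  qed
  have A_dec: "A n \<le> A m" if "m \<le> n" for m n
    using A_mult[OF that] A_pos[of m] pos a_le by (simp add: prod_le_1 less_imp_le mult_left_le)
  have "decseq A" using A_dec by (simp add: decseq_def)
  then obtain b where b: "A \<longlonglongrightarrow> b" "\<And>n. b \<le> A n"
    using decseq_convergent[of A 0] A_pos by (auto simp: less_imp_le)
  have b0: "0 \<le> b" by (rule LIMSEQ_le_const[OF b(1)]) (use A_pos in \<open>auto simp: less_imp_le\<close>)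
  have b1: "b \<le> 1" using b(2)[of 0] by (simp add: A_def)
  have part_a: "weakly_tendsto_L2 (\<lambda>n. poly (S n)) (\<lambda>_. 0)" if "b = 0"
  proof (rule weakly_tendsto_zero_if_coeffs_tendsto_zero)
    show "(\<integral>z. (cmod (poly (S n) z))\<^sup>2 \<partial>dz) \<le> 1" for n unfolding S_Q by (rule Q_norm)
    show "(\<lambda>n. coeff (S n) k) \<longlonglongrightarrow> 0" for k
      unfolding S_Q
    proof (rule coeffs_of_tails_tendsto_zero[of Q, OF Q_mult Q_coeff])
      fix m
      have "(\<lambda>n. complex_of_real (A n / A m)) \<longlonglongrightarrow> of_real (0 / A m)"
        using b(1) A_pos[of m] that by (intro tendsto_of_real tendsto_divide tendsto_const) auto
      moreover have "\<forall>\<^sub>F n in sequentially. complex_of_real (A n / A m) = coeff (Q m n) 0"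
        using eventually_ge_at_top[of m]
        by eventually_elim (use A_mult A_pos[of m] in \<open>simp add: Q_const\<close>)
      ultimately show "(\<lambda>n. coeff (Q m n) 0) \<longlonglongrightarrow> 0"
        by (simp add: Lim_transform_eventually)
    qed
  qed
  have part_b: "\<exists>f F. f \<in> Lp_circle 1 \<and>
         (\<lambda>n. Lp_norm 1 (\<lambda>z. poly (S n) z - f z)) \<longlonglongrightarrow> 0 \<and>
         hardy_boundary 1 F f \<and>
         (\<lambda>n. hardy_norm 1 (\<lambda>z. poly (S n) z - F z)) \<longlonglongrightarrow> 0 \<and>
         \<not> (AE z in dz. f z = 0) \<and>
         hardy_boundary 2 F f \<and> hardy_norm 2 F \<le> 1 \<and>
         log_integrable f" if bpos: "b > 0"
  proof -
    have S_norm: "(\<integral>z. (cmod (poly (S n) z))\<^sup>2 \<partial>dz) \<le> 1" for n unfolding S_Q by (rule Q_norm)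
    have dist: "(\<integral>z. cmod (poly (S n) z - poly (S m) z) \<partial>dz) \<le> sqrt (2 * (1 - b / A m))" if "m \<le> n" for m n
    proof -
      have "(\<integral>z. cmod (poly (S n) z - poly (S m) z) \<partial>dz) \<le> sqrt (2 * (1 - (\<Prod>j\<in>{m..<n}. a j)))"
        using L1_dist_product_le[OF S_norm[of m] Q_norm[of m n] Q_const] Q_mult[of 0 m n] that by (simp add: S_Q)
      also have "(\<Prod>j\<in>{m..<n}. a j) = A n / A m" using A_mult[OF that] A_pos[of m] by simp
      also have "sqrt (2 * (1 - A n / A m)) \<le> sqrt (2 * (1 - b / A m))"
        using b(2)[of n] A_pos[of m] by (simp add: divide_right_mono)
      finally show ?thesis .
    qed
    have "(\<lambda>m. sqrt (2 * (1 - b / A m))) \<longlonglongrightarrow> sqrt (2 * (1 - b / b))"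
      using b(1) bpos by (intro tendsto_real_sqrt tendsto_mult tendsto_diff tendsto_divide tendsto_const) auto
    then have dist0: "(\<lambda>m. sqrt (2 * (1 - b / A m))) \<longlonglongrightarrow> 0" using bpos by simp
    obtain f where f: "integrable dz f" and lim: "(\<lambda>n. \<integral>z. cmod (poly (S n) z - f z) \<partial>dz) \<longlonglongrightarrow> 0"
    proof (rule L1_cauchy_imp_convergent[of dz "\<lambda>n z. poly (S n) z"])
      fix e :: real assume "e > 0"
      then have "\<forall>\<^sub>F m in sequentially. sqrt (2 * (1 - b / A m)) < e"
        using dist0 by (rule order_tendstoD(2)[rotated])
      then obtain N where N: "\<And>m. m \<ge> N \<Longrightarrow> sqrt (2 * (1 - b / A m)) < e" by (auto simp: eventually_sequentially)
      have "(\<integral>z. cmod (poly (S i) z - poly (S j) z) \<partial>dz) < e" if "i \<ge> N" "j \<ge> N" for i j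
      proof (cases "i \<le> j")
        case True
        then show ?thesis using dist[OF True] N[OF that(1)] by (simp add: norm_minus_commute)
      next
        case False
        then show ?thesis using dist[of j i] N[OF that(2)] by simp
      qed
      then show "\<exists>N. \<forall>i\<ge>N. \<forall>j\<ge>N. (\<integral>z. cmod (poly (S i) z - poly (S j) z) \<partial>dz) < e" by blast
    qed (use integrable_dz_poly in auto)
    have log: "log_integrable f"
    proof (rule log_integrable_L1_limit[OF f lim bpos])
      fix n
      have "poly (S n) 0 = of_real (A n)"
        by (simp add: S_Q poly_0_coeff_0 Q_const A_def lessThan_atLeast0)
      then show "b \<le> cmod (poly (S n) 0)" using b(2)[of n] A_pos[of n] by simp
    qed
    have "\<not> (AE z in dz. f z = 0)"
    proof
      assume "AE z in dz. f z = 0"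
      moreover have "AE z in dz. f z \<noteq> 0" using log by (simp add: log_integrable_def)
      ultimately have "AE z in dz. False" by eventually_elim simp
      then show False using prob_space.AE_False[OF prob_space_dz] by simp
    qed
    then show ?thesis
      using f lim log H1_limit_properties[OF f lim] H2_limit_properties[OF f lim S_norm]
      by (intro exI[of _ f] exI[of _ "hardy_extension f"]) (simp add: Lp_circle_1 Lp_norm_1)
  qed
  show ?thesis
    using b(1) b0 b1 part_a part_b unfolding A_def by (intro bexI[of _ b]) auto
qed

end
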